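(* Let $Z=\{Z_t,t\ge 0\}$ be a continuous centered stationary Gaussian process with $f_Z:=\mathbb{E}[Z_0^2]>0$ and covariance $\rho(t)=\rho(-t):=\mathbb{E}[Z_0Z_t]$, $t\ge0$, satisfying $\int_{\mathbb{R}}\rho^2(r)\,dr<\infty$. Let $\Delta_n>0$ with $\Delta_n\to0$ and $T_n:=n\Delta_n\to\infty$, and put $t_i=i\Delta_n$, $i=0,\dots,n$. Let $\widehat f_T(Z):=\frac1T\int_0^TZ_t^2\,dt$ and $\widetilde f_n(Z):=\frac1n\sum_{i=1}^nZ_{t_i}^2$. Then the estimator $\widetilde f_n(Z)$ is unbiased, i.e. $\mathbb{E}[\widetilde f_n(Z)]=f_Z$. Assume that, for some constants $c>0$ and $0<\alpha<1$, $\mathbb{E}[|Z_t-Z_s|^2]\le c|t-s|^{2\alpha}$ for all $s,t\ge0$ such that $|s-t|$ is small enough. Then $$\mathbb{E}\,|\widehat f_{T_n}(Z)-\widetilde f_n(Z)|^2\le C_\alpha\Delta_n^{2\alpha},$$ where $C_\alpha>0$ is a constant that depends only on $\alpha$. Moreover, if $n\Delta_n^\eta\to0$ as $n\to\infty$ for some $\eta>1$, then $\widetilde f_n(Z)$ is strongly consistent, i.e. $\widetilde f_n(Z)\to f_Z$ almost surely as $n\to\infty$.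
   Formalization: The constant in the mean-square bound may depend on α, c, f_Z and the range of |s−t| where the Hölder condition holds, not on α alone: replacing Z by λZ multiplies the left side by λ⁴, so a constant depending only on α is impossible. *)

theory Defs
  imports "HOL-Probability.Probability"
begin

text \<open>Processes are indexed by real numbers, but only the times \<open>t \<ge> 0\<close> are ever constrained or
  used. One-dimensional Gaussian laws may be degenerate (point masses), as is needed to define
  Gaussian processes through their linear combinations.\<close>

definition gaussian_rv :: "'a measure \<Rightarrow> ('a \<Rightarrow> real) \<Rightarrow> bool" where
  "gaussian_rv M X \<longleftrightarrow> X \<in> borel_measurable M \<and>
     ((\<exists>\<mu> \<sigma>. \<sigma> > 0 \<and> distributed M lborel X (\<lambda>x. ennreal (normal_density \<mu> \<sigma> x))) \<or>
      (\<exists>\<mu>. AE \<omega> in M. X \<omega> = \<mu>))"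

definition gaussian_process :: "'a measure \<Rightarrow> (real \<Rightarrow> 'a \<Rightarrow> real) \<Rightarrow> bool" where
  "gaussian_process M Z \<longleftrightarrow>
     (\<forall>J a. finite J \<and> J \<subseteq> {0..} \<longrightarrow> gaussian_rv M (\<lambda>\<omega>. \<Sum>t\<in>J. a t * Z t \<omega>))"

definition centered_process :: "'a measure \<Rightarrow> (real \<Rightarrow> 'a \<Rightarrow> real) \<Rightarrow> bool" where
  "centered_process M Z \<longleftrightarrow> (\<forall>t\<ge>0. integrable M (Z t) \<and> (\<integral>\<omega>. Z t \<omega> \<partial>M) = 0)"

definition stationary_process :: "'a measure \<Rightarrow> (real \<Rightarrow> 'a \<Rightarrow> real) \<Rightarrow> bool" where
  "stationary_process M Z \<longleftrightarrow>
     (\<forall>J h. finite J \<and> J \<subseteq> {0..} \<and> h \<ge> 0 \<longrightarrow>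
        distr M (\<Pi>\<^sub>M t\<in>J. borel) (\<lambda>\<omega>. \<lambda>t\<in>J. Z (t + h) \<omega>) =
        distr M (\<Pi>\<^sub>M t\<in>J. borel) (\<lambda>\<omega>. \<lambda>t\<in>J. Z t \<omega>))"

definition continuous_process :: "'a measure \<Rightarrow> (real \<Rightarrow> 'a \<Rightarrow> real) \<Rightarrow> bool" where
  "continuous_process M Z \<longleftrightarrow> (\<forall>\<omega>\<in>space M. continuous_on {0..} (\<lambda>t. Z t \<omega>))"

definition second_moment :: "'a measure \<Rightarrow> (real \<Rightarrow> 'a \<Rightarrow> real) \<Rightarrow> real" where
  "second_moment M Z = (\<integral>\<omega>. (Z 0 \<omega>)\<^sup>2 \<partial>M)"

text \<open>The covariance function, extended to negative arguments by evenness.\<close>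

definition autocov :: "'a measure \<Rightarrow> (real \<Rightarrow> 'a \<Rightarrow> real) \<Rightarrow> real \<Rightarrow> real" where
  "autocov M Z t = (\<integral>\<omega>. Z 0 \<omega> * Z \<bar>t\<bar> \<omega> \<partial>M)"

definition f_hat :: "(real \<Rightarrow> 'a \<Rightarrow> real) \<Rightarrow> real \<Rightarrow> 'a \<Rightarrow> real" where
  "f_hat Z T \<omega> = 1 / T * (LBINT t:{0..T}. (Z t \<omega>)\<^sup>2)"

text \<open>Here \<open>d\<close> is the sampling step, so the observation times are \<open>i d\<close> for \<open>i = 1, \<dots>, n\<close>.\<close>

definition f_tilde :: "(real \<Rightarrow> 'a \<Rightarrow> real) \<Rightarrow> real \<Rightarrow> nat \<Rightarrow> 'a \<Rightarrow> real" where
  "f_tilde Z d n \<omega> = 1 / real n * (\<Sum>i=1..n. (Z (real i * d) \<omega>)\<^sup>2)"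

definition sampling_scheme :: "(nat \<Rightarrow> real) \<Rightarrow> bool" where
  "sampling_scheme \<Delta> \<longleftrightarrow> (\<forall>n\<ge>1. \<Delta> n > 0) \<and> \<Delta> \<longlonglongrightarrow> 0 \<and>
     filterlim (\<lambda>n. real n * \<Delta> n) at_top sequentially"

text \<open>The mean-square Hoelder condition; \<open>\<delta>\<close> makes explicit how small \<open>\<bar>t - s\<bar>\<close> has to be.\<close>

definition mean_square_hoelder ::
  "'a measure \<Rightarrow> (real \<Rightarrow> 'a \<Rightarrow> real) \<Rightarrow> real \<Rightarrow> real \<Rightarrow> real \<Rightarrow> bool" where
  "mean_square_hoelder M Z c \<alpha> \<delta> \<longleftrightarrow>
     (\<forall>s\<ge>0. \<forall>t\<ge>0. \<bar>t - s\<bar> < \<delta> \<longrightarrow>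
        (\<integral>\<omega>. \<bar>Z t \<omega> - Z s \<omega>\<bar>\<^sup>2 \<partial>M) \<le> c * \<bar>t - s\<bar> powr (2 * \<alpha>))"

end

theory Submission
  imports Defs
begin

text \<open>Unbiasedness is stationarity: every \<open>Z t\<close> has second moment \<open>f\<^sub>Z\<close>. The other two claims rest on
  moments of time averages, in which \<open>f_hat\<close> and \<open>f_tilde\<close> are both written as expectations over
  a uniform time \<open>t\<close> in \<open>[0, T]\<close>, \<open>T = n d\<close>.

  \<^emph>\<open>Discretization error.\<close> The sum \<open>f_tilde\<close> is the time average of the squared process read at the
  next grid point \<open>\<tau> t = d \<lceil>t / d\<rceil>\<close>, so the error is the time average of
  \<open>(Z t)\<^sup>2 - (Z (\<tau> t))\<^sup>2 = (Z t - Z (\<tau> t)) (Z t + Z (\<tau> t))\<close>. By Jensen and Fubini, its moment of order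
  \<open>2 m\<close> is at most the largest such moment of the integrand (\<open>time_average_even_moment_le\<close>).
  Both factors are centred Gaussian, hence Cauchy--Schwarz and the explicit Gaussian moments bound
  that moment by a constant times \<open>(E (Z t - Z (\<tau> t))\<^sup>2 f\<^sub>Z)^m\<close>, which the Hoelder condition makes
  \<open>O(d powr (2 \<alpha> m))\<close> (\<open>discretization_error_moment\<close>). The case \<open>m = 1\<close> is the mean-square bound.
  Steps \<open>d\<close> beyond the range \<open>\<delta>\<close> of the Hoelder condition are covered because increments always have
  second moment at most \<open>4 f\<^sub>Z\<close>, so the condition holds globally with a larger constant.

  If \<open>n \<Delta>\<^sub>n powr \<eta> \<longlonglongrightarrow> 0\<close>, then \<open>\<Delta>\<^sub>n\<close> decays at least like a negative power of \<open>n\<close>, and for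
  large \<open>m\<close> these moments are summable. A sequence of nonnegative variables with summable
  expectations tends to \<open>0\<close> almost surely, so the discretization error does.

  \<^emph>\<open>Continuous-time average.\<close> Writing \<open>\<rho>\<close> for the covariance function, the covariance of
  \<open>(Z s)\<^sup>2\<close> and \<open>(Z t)\<^sup>2\<close> is \<open>2 \<rho>(t - s)\<^sup>2\<close> by Isserlis' formula (\<open>centered_gaussian_square_product\<close>), so \<open>f_hat\<close> at horizon
  \<open>T\<close> has variance at most \<open>2 / T\<close> times the integral of \<open>\<rho>\<^sup>2\<close> (\<open>f_hat_variance\<close>). This is summable along
  \<open>T = k\<^sup>2\<close>, which gives almost sure convergence along the squares. Since the integral of \<open>Z\<^sup>2\<close> over
  \<open>[0, T]\<close> increases with \<open>T\<close>, it extends to all \<open>T\<close> (\<open>mono_average_tendsto_at_top\<close>).\<close>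

section \<open>Moments of centred Gaussian variables\<close>

lemma (in prob_space) centered_gaussian_even_moment:
  assumes X: "gaussian_rv M X" and mean: "expectation X = 0"
  shows "has_bochner_integral M (\<lambda>\<omega>. X \<omega> ^ (2 * k))
    (fact (2 * k) / (2 ^ k * fact k) * expectation (\<lambda>\<omega>. (X \<omega>)\<^sup>2) ^ k)"
proof -
  have [measurable]: "X \<in> borel_measurable M"
    using X by (simp add: gaussian_rv_def)
  consider (normal) \<mu> \<sigma> where "\<sigma> > 0" "distributed M lborel X (\<lambda>x. ennreal (normal_density \<mu> \<sigma> x))"
    | (degenerate) \<mu> where "AE \<omega> in M. X \<omega> = \<mu>"
    using X unfolding gaussian_rv_def by blast
  then show ?thesis
  proof cases
    case normal
    have "\<mu> = 0"
      using normal_distributed_expectation[OF normal(1) normal(2)] mean by simp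
    then have D: "distributed M lborel X (\<lambda>x. ennreal (normal_density 0 \<sigma> x))"
      using normal by simp
    have moment: "has_bochner_integral M (\<lambda>\<omega>. X \<omega> ^ (2 * j)) (fact (2 * j) / ((2 / \<sigma>\<^sup>2) ^ j * fact j))" for j
    proof -
      have "has_bochner_integral lborel (\<lambda>x. normal_density 0 \<sigma> x * x ^ (2 * j))
          (fact (2 * j) / ((2 / \<sigma>\<^sup>2) ^ j * fact j))"
        using normal_moment_even[OF normal(1), of 0 j] by simp
      then show ?thesis
        using distributed_integrable[OF D, of "\<lambda>x. x ^ (2 * j)"]
          distributed_integral[OF D, of "\<lambda>x. x ^ (2 * j)"] normal(1)
        by (simp add: has_bochner_integral_iff)
    qed
    have "expectation (\<lambda>\<omega>. (X \<omega>)\<^sup>2) = \<sigma>\<^sup>2"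
      using has_bochner_integral_integral_eq[OF moment[of 1]] by simp
    then show ?thesis
      using moment[of k] normal(1) by (simp add: power_divide field_simps)
  next
    case degenerate
    then have "expectation X = expectation (\<lambda>_. \<mu>)"
      by (intro integral_cong_AE) auto
    then have "\<mu> = 0"
      using mean by (simp add: prob_space)
    then have zero: "AE \<omega> in M. X \<omega> = 0"
      using degenerate by simp
    then have "expectation (\<lambda>\<omega>. (X \<omega>)\<^sup>2) = 0"
      by (subst integral_cong_AE[where g = "\<lambda>_. 0"]) auto
    \<comment> \<open>For \<open>k = 0\<close> both sides are \<open>0 ^ 0 = 1\<close>, so the formula survives degeneration.\<close>
    moreover have "has_bochner_integral M (\<lambda>\<omega>. X \<omega> ^ (2 * k)) (0 ^ (2 * k))"
      using zero by (subst has_bochner_integral_cong_AE[where g = "\<lambda>_. 0 ^ (2 * k)"])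
        (auto simp: has_bochner_integral_iff prob_space)
    ultimately show ?thesis
      by (cases k) auto
  qed
qed

text \<open>The double factorial \<open>(4 m - 1)!!\<close>: the moment of order \<open>4 m\<close> of a centred Gaussian variable,
  divided by the power \<open>2 m\<close> of its variance.\<close>

definition gaussian_moment_ratio :: "nat \<Rightarrow> real" where
  "gaussian_moment_ratio m = fact (4 * m) / (2 ^ (2 * m) * fact (2 * m))"

lemma gaussian_moment_ratio_pos: "gaussian_moment_ratio m > 0"
  by (simp add: gaussian_moment_ratio_def)

text \<open>Cauchy--Schwarz reduces the moment of the product to the moments of order \<open>4 m\<close> of the two
  variables, which the marginal laws determine.\<close>

lemma (in prob_space) centered_gaussian_product_moment:
  assumes X: "gaussian_rv M X" "expectation X = 0"
    and Y: "gaussian_rv M Y" "expectation Y = 0"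
  shows "(\<integral>\<^sup>+\<omega>. ennreal ((X \<omega> * Y \<omega>) ^ (2 * m)) \<partial>M) \<le>
    ennreal (gaussian_moment_ratio m * expectation (\<lambda>\<omega>. (X \<omega>)\<^sup>2) ^ m * expectation (\<lambda>\<omega>. (Y \<omega>)\<^sup>2) ^ m)"
    (is "?I \<le> ennreal ?r")
proof -
  have [measurable]: "X \<in> borel_measurable M" "Y \<in> borel_measurable M"
    using X Y by (simp_all add: gaussian_rv_def)
  have sq: "(\<integral>\<^sup>+\<omega>. (ennreal (W \<omega> ^ (2 * m)))\<^sup>2 \<partial>M) =
      ennreal (gaussian_moment_ratio m * expectation (\<lambda>\<omega>. (W \<omega>)\<^sup>2) ^ (2 * m))"
    if "gaussian_rv M W" "expectation W = 0" for W
  proof -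
    have "(\<integral>\<^sup>+\<omega>. (ennreal (W \<omega> ^ (2 * m)))\<^sup>2 \<partial>M) = (\<integral>\<^sup>+\<omega>. ennreal (W \<omega> ^ (2 * (2 * m))) \<partial>M)"
      by (intro nn_integral_cong, subst ennreal_power) (simp, simp add: mult.commute flip: power_mult)
    also have "\<dots> = ennreal (expectation (\<lambda>\<omega>. W \<omega> ^ (2 * (2 * m))))"
      using centered_gaussian_even_moment[OF that, of "2 * m"]
      by (intro nn_integral_eq_integral) (auto simp: has_bochner_integral_iff power_mult)
    also have "expectation (\<lambda>\<omega>. W \<omega> ^ (2 * (2 * m))) =
        gaussian_moment_ratio m * expectation (\<lambda>\<omega>. (W \<omega>)\<^sup>2) ^ (2 * m)"
      using has_bochner_integral_integral_eq[OF centered_gaussian_even_moment[OF that, of "2 * m"]]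
      by (simp add: gaussian_moment_ratio_def)
    finally show ?thesis .
  qed
  have "?I = (\<integral>\<^sup>+\<omega>. ennreal (X \<omega> ^ (2 * m)) * ennreal (Y \<omega> ^ (2 * m)) \<partial>M)"
    by (simp add: power_mult_distrib ennreal_mult)
  then have "?I\<^sup>2 \<le> (\<integral>\<^sup>+\<omega>. (ennreal (X \<omega> ^ (2 * m)))\<^sup>2 \<partial>M) * (\<integral>\<^sup>+\<omega>. (ennreal (Y \<omega> ^ (2 * m)))\<^sup>2 \<partial>M)"
    by (simp add: Cauchy_Schwarz_nn_integral)
  also have "\<dots> = ennreal (?r\<^sup>2)"
    unfolding sq[OF X] sq[OF Y] using gaussian_moment_ratio_pos[of m]
    by (simp add: power_mult_distrib power2_eq_square power_mult algebra_simps flip: ennreal_mult)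
  finally have le: "?I\<^sup>2 \<le> ennreal (?r\<^sup>2)" .
  have r: "?r \<ge> 0"
    using gaussian_moment_ratio_pos[of m] by simp
  show ?thesis
  proof (cases ?I)
    case (real x)
    then have "x\<^sup>2 \<le> ?r\<^sup>2"
      using le by (simp add: ennreal_power)
    then show ?thesis
      using real r power2_le_imp_le by (simp add: ennreal_leI)
  next
    case top
    then show ?thesis
      using le by (simp add: top_unique)
  qed
qed

text \<open>Isserlis' formula for two variables, by polarization: \<open>12 X\<^sup>2 Y\<^sup>2\<close> equals
  \<open>(X + Y)^4 + (X - Y)^4 - 2 X^4 - 2 Y^4\<close>, and each fourth moment is three times a squared variance.
  Thus the one-dimensional law of linear combinations suffices.\<close>

lemma (in prob_space) centered_gaussian_square_product:
  assumes X: "gaussian_rv M X" "expectation X = 0"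
    and Y: "gaussian_rv M Y" "expectation Y = 0"
    and add: "gaussian_rv M (\<lambda>\<omega>. X \<omega> + Y \<omega>)" "expectation (\<lambda>\<omega>. X \<omega> + Y \<omega>) = 0"
    and diff: "gaussian_rv M (\<lambda>\<omega>. X \<omega> - Y \<omega>)" "expectation (\<lambda>\<omega>. X \<omega> - Y \<omega>) = 0"
  shows "has_bochner_integral M (\<lambda>\<omega>. (X \<omega>)\<^sup>2 * (Y \<omega>)\<^sup>2)
    (expectation (\<lambda>\<omega>. (X \<omega>)\<^sup>2) * expectation (\<lambda>\<omega>. (Y \<omega>)\<^sup>2) + 2 * (expectation (\<lambda>\<omega>. X \<omega> * Y \<omega>))\<^sup>2)"
proof -
  let ?E = expectation
  define a where "a = ?E (\<lambda>\<omega>. (X \<omega>)\<^sup>2)"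
  define b where "b = ?E (\<lambda>\<omega>. (Y \<omega>)\<^sup>2)"
  define r where "r = ?E (\<lambda>\<omega>. X \<omega> * Y \<omega>)"
  have fourth: "has_bochner_integral M (\<lambda>\<omega>. W \<omega> ^ 4) (3 * (?E (\<lambda>\<omega>. (W \<omega>)\<^sup>2))\<^sup>2)"
    and second: "integrable M (\<lambda>\<omega>. (W \<omega>)\<^sup>2)"
    if "gaussian_rv M W" "?E W = 0" for W
    using centered_gaussian_even_moment[OF that, of 2] centered_gaussian_even_moment[OF that, of 1]
    by (simp_all add: fact_numeral has_bochner_integral_iff)
  note int2 = second[OF X] second[OF Y] second[OF add] second[OF diff]
  have XY: "X \<omega> * Y \<omega> = (1/4) * ((X \<omega> + Y \<omega>)\<^sup>2 - (X \<omega> - Y \<omega>)\<^sup>2)" for \<omega>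
    by (simp add: power2_eq_square algebra_simps)
  have intXY: "integrable M (\<lambda>\<omega>. X \<omega> * Y \<omega>)"
    unfolding XY using int2 by (intro integrable_mult_right Bochner_Integration.integrable_diff)
  have s: "?E (\<lambda>\<omega>. (X \<omega> + Y \<omega>)\<^sup>2) = a + b + 2 * r"
    unfolding a_def b_def r_def power2_sum using int2 intXY
    by (simp add: mult.assoc)
  have d: "?E (\<lambda>\<omega>. (X \<omega> - Y \<omega>)\<^sup>2) = a + b - 2 * r"
    unfolding a_def b_def r_def power2_diff using int2 intXY
    by (simp add: mult.assoc)
  have "has_bochner_integral M
      (\<lambda>\<omega>. (1/12) * ((X \<omega> + Y \<omega>) ^ 4 + (X \<omega> - Y \<omega>) ^ 4 - 2 * X \<omega> ^ 4 - 2 * Y \<omega> ^ 4))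
      ((1/12) * (3 * (a + b + 2 * r)\<^sup>2 + 3 * (a + b - 2 * r)\<^sup>2 - 2 * (3 * a\<^sup>2) - 2 * (3 * b\<^sup>2)))"
    using fourth[OF X] fourth[OF Y] fourth[OF add] fourth[OF diff] unfolding s d a_def[symmetric] b_def[symmetric]
    by (intro has_bochner_integral_mult_right has_bochner_integral_diff has_bochner_integral_add)
  moreover have "(1/12) * ((X \<omega> + Y \<omega>) ^ 4 + (X \<omega> - Y \<omega>) ^ 4 - 2 * X \<omega> ^ 4 - 2 * Y \<omega> ^ 4) = (X \<omega>)\<^sup>2 * (Y \<omega>)\<^sup>2" for \<omega>
    by (simp add: power4_eq_xxxx power2_eq_square algebra_simps)
  moreover have "(1/12) * (3 * (a + b + 2 * r)\<^sup>2 + 3 * (a + b - 2 * r)\<^sup>2 - 2 * (3 * a\<^sup>2) - 2 * (3 * b\<^sup>2)) = a * b + 2 * r\<^sup>2"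
    by (simp add: power2_eq_square algebra_simps)
  ultimately show ?thesis
    by (simp only: a_def b_def r_def)
qed

section \<open>Time averages of random functions\<close>

text \<open>The process read at times rounded down to a grid takes countably many times, hence is jointly
  measurable; it converges to the process as the grid is refined.\<close>

lemma continuous_paths_jointly_measurable:
  fixes Y :: "real \<Rightarrow> 'a \<Rightarrow> real"
  assumes [measurable]: "\<And>t. Y t \<in> borel_measurable M"
    and cont: "\<And>\<omega>. \<omega> \<in> space M \<Longrightarrow> continuous_on UNIV (\<lambda>t. Y t \<omega>)"
  shows "(\<lambda>(t, \<omega>). Y t \<omega>) \<in> borel_measurable (borel \<Otimes>\<^sub>M M)"
proof (rule borel_measurable_LIMSEQ_real)
  define q where "q n t = real_of_int \<lfloor>t * real (Suc n)\<rfloor> / real (Suc n)" for n t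
  define u where "u = (\<lambda>n p. Y (q n (fst p)) (snd p))"
  show "u n \<in> borel_measurable (borel \<Otimes>\<^sub>M M)" for n
  proof -
    have "(\<lambda>p. (\<lambda>(i::int) p. Y (real_of_int i / real (Suc n)) (snd p)) \<lfloor>fst p * real (Suc n)\<rfloor> p)
        \<in> borel_measurable (borel \<Otimes>\<^sub>M M)"
      by (rule measurable_compose_countable[where f = "\<lambda>(i::int) p. Y (real_of_int i / real (Suc n)) (snd p)"])
        measurable
    then show ?thesis
      by (simp add: u_def q_def)
  qed
  show "(\<lambda>n. u n p) \<longlonglongrightarrow> (case p of (t, \<omega>) \<Rightarrow> Y t \<omega>)" if p: "p \<in> space (borel \<Otimes>\<^sub>M M)" for p
  proof -
    obtain t \<omega> where [simp]: "p = (t, \<omega>)" and \<omega>: "\<omega> \<in> space M"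
      using p by (auto simp: space_pair_measure)
    have "(\<lambda>n. q n t) \<longlonglongrightarrow> t"
    proof (rule tendsto_sandwich)
      show "\<forall>\<^sub>F n in sequentially. t - 1 / real (Suc n) \<le> q n t"
      proof (intro always_eventually allI)
        fix n
        have "(t * real (Suc n) - 1) / real (Suc n) \<le> q n t"
          unfolding q_def by (intro divide_right_mono) linarith+
        then show "t - 1 / real (Suc n) \<le> q n t"
          by (simp add: diff_divide_distrib)
      qed
      show "\<forall>\<^sub>F n in sequentially. q n t \<le> t"
        unfolding q_def by (intro always_eventually allI) (simp only: divide_le_eq, simp)
      show "(\<lambda>n. t - 1 / real (Suc n)) \<longlonglongrightarrow> t"
        using tendsto_diff[OF tendsto_const[of t] LIMSEQ_inverse_real_of_nat] by (simp add: inverse_eq_divide)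
    qed simp
    moreover have "isCont (\<lambda>t. Y t \<omega>) t"
      using cont[OF \<omega>] by (simp add: continuous_on_eq_continuous_at)
    ultimately show ?thesis
      using isCont_tendsto_compose[of t "\<lambda>t. Y t \<omega>" "\<lambda>n. q n t" sequentially] by (simp add: u_def)
  qed
qed

text \<open>The form of Borel--Cantelli used for both almost sure limits: the random series has finite
  expectation, so it converges almost surely and its terms tend to \<open>0\<close>.\<close>

lemma (in prob_space) summable_expectation_imp_AE_tendsto_0:
  fixes Y :: "nat \<Rightarrow> 'a \<Rightarrow> real"
  assumes [measurable]: "\<And>n. Y n \<in> borel_measurable M"
    and nonneg: "\<And>n \<omega>. Y n \<omega> \<ge> 0"
    and le: "\<And>n. (\<integral>\<^sup>+\<omega>. ennreal (Y n \<omega>) \<partial>M) \<le> ennreal (b n)"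
    and b: "summable b" "\<And>n. b n \<ge> 0"
  shows "AE \<omega> in M. (\<lambda>n. Y n \<omega>) \<longlonglongrightarrow> 0"
proof -
  have "(\<integral>\<^sup>+\<omega>. (\<Sum>n. ennreal (Y n \<omega>)) \<partial>M) = (\<Sum>n. \<integral>\<^sup>+\<omega>. ennreal (Y n \<omega>) \<partial>M)"
    by (rule nn_integral_suminf) measurable
  also have "\<dots> \<le> (\<Sum>n. ennreal (b n))"
    by (rule suminf_le) (use le in auto)
  also have "\<dots> < \<infinity>"
    using suminf_ennreal2[OF b(2) b(1)] by simp
  finally have "AE \<omega> in M. (\<Sum>n. ennreal (Y n \<omega>)) \<noteq> \<infinity>"
    by (intro nn_integral_PInf_AE) auto
  then show ?thesis
  proof eventually_elim
    case (elim \<omega>)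
    then have "summable (\<lambda>n. Y n \<omega>)"
      using nonneg by (intro summable_suminf_not_top) auto
    then show ?case
      by (rule summable_LIMSEQ_zero)
  qed
qed

text \<open>Jensen's inequality for the convex function \<open>x ^ (2 m)\<close> moves the power inside the time average;
  Tonelli's theorem then takes the expectation at fixed times.\<close>

lemma time_average_even_moment_le:
  fixes g :: "'t \<Rightarrow> 'a \<Rightarrow> real"
  assumes U: "prob_space U" and M: "prob_space M"
    and g[measurable]: "(\<lambda>(t, \<omega>). g t \<omega>) \<in> borel_measurable (U \<Otimes>\<^sub>M M)"
    and bounded: "\<And>\<omega>. \<omega> \<in> space M \<Longrightarrow> \<exists>K. AE t in U. \<bar>g t \<omega>\<bar> \<le> K"
    and moment: "\<And>t. t \<in> space U \<Longrightarrow> (\<integral>\<^sup>+\<omega>. ennreal (g t \<omega> ^ (2 * m)) \<partial>M) \<le> B"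
  shows "(\<integral>\<^sup>+\<omega>. ennreal ((\<integral>t. g t \<omega> \<partial>U) ^ (2 * m)) \<partial>M) \<le> B"
proof -
  interpret U: prob_space U by fact
  interpret M: prob_space M by fact
  interpret P: pair_sigma_finite U M ..
  have "(\<integral>\<^sup>+\<omega>. ennreal ((\<integral>t. g t \<omega> \<partial>U) ^ (2 * m)) \<partial>M) \<le> (\<integral>\<^sup>+\<omega>. (\<integral>\<^sup>+t. ennreal (g t \<omega> ^ (2 * m)) \<partial>U) \<partial>M)"
  proof (rule nn_integral_mono)
    fix \<omega> assume \<omega>[measurable]: "\<omega> \<in> space M"
    have [measurable]: "(\<lambda>t. g t \<omega>) \<in> borel_measurable U"
      using measurable_compose[OF measurable_Pair2'[OF \<omega>] g] by simp
    obtain K where K: "AE t in U. \<bar>g t \<omega>\<bar> \<le> K"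
      using bounded[OF \<omega>] by blast
    have i1: "integrable U (\<lambda>t. g t \<omega>)"
      by (rule U.integrable_const_bound[of _ K]) (use K in auto)
    have i2: "integrable U (\<lambda>t. g t \<omega> ^ (2 * m))"
    proof (rule U.integrable_const_bound[of _ "K ^ (2 * m)"])
      show "AE t in U. norm (g t \<omega> ^ (2 * m)) \<le> K ^ (2 * m)"
        using K by eventually_elim (auto simp only: real_norm_def power_abs intro: power_mono)
    qed measurable
    have "(\<integral>t. g t \<omega> \<partial>U) ^ (2 * m) \<le> (\<integral>t. g t \<omega> ^ (2 * m) \<partial>U)"
      using U.jensens_inequality[where X = "\<lambda>t. g t \<omega>" and I = UNIV and q = "\<lambda>x. x ^ (2 * m)"] i1 i2
      by (simp add: convex_power_even)
    then have "ennreal ((\<integral>t. g t \<omega> \<partial>U) ^ (2 * m)) \<le> ennreal (\<integral>t. g t \<omega> ^ (2 * m) \<partial>U)"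
      by (rule ennreal_leI)
    also have "\<dots> = (\<integral>\<^sup>+t. ennreal (g t \<omega> ^ (2 * m)) \<partial>U)"
      using i2 by (intro nn_integral_eq_integral[symmetric]) auto
    finally show "ennreal ((\<integral>t. g t \<omega> \<partial>U) ^ (2 * m)) \<le> (\<integral>\<^sup>+t. ennreal (g t \<omega> ^ (2 * m)) \<partial>U)" .
  qed
  also have "\<dots> = (\<integral>\<^sup>+t. (\<integral>\<^sup>+\<omega>. ennreal (g t \<omega> ^ (2 * m)) \<partial>M) \<partial>U)"
    by (rule P.Fubini') measurable
  also have "\<dots> \<le> (\<integral>\<^sup>+t. B \<partial>U)"
    by (intro nn_integral_mono moment)
  also have "\<dots> = B"
    by (simp add: U.emeasure_space_1)
  finally show ?thesis .
qed

text \<open>The square of a time average is an average over two independent times, that is, over the product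
  measure. The uniform bound on second moments makes the product of the two values integrable in
  time and chance, so Fubini's theorem applies.\<close>

lemma expectation_square_time_average:
  fixes W :: "'t \<Rightarrow> 'a \<Rightarrow> real"
  assumes U: "prob_space U" and M: "prob_space M"
    and W[measurable]: "(\<lambda>(t, \<omega>). W t \<omega>) \<in> borel_measurable (U \<Otimes>\<^sub>M M)"
    and path: "\<And>\<omega>. \<omega> \<in> space M \<Longrightarrow> integrable U (\<lambda>t. W t \<omega>)"
    and second: "\<And>t. t \<in> space U \<Longrightarrow> (\<integral>\<^sup>+\<omega>. ennreal ((W t \<omega>)\<^sup>2) \<partial>M) \<le> ennreal B"
  shows "(\<integral>\<omega>. (\<integral>t. W t \<omega> \<partial>U)\<^sup>2 \<partial>M) = (\<integral>t. (\<integral>s. (\<integral>\<omega>. W t \<omega> * W s \<omega> \<partial>M) \<partial>U) \<partial>U)"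
proof -
  interpret U: prob_space U by fact
  interpret M: prob_space M by fact
  interpret UU: pair_prob_space U U ..
  interpret P: pair_sigma_finite "U \<Otimes>\<^sub>M U" M ..
  let ?V = "\<lambda>(t, s) \<omega>. W t \<omega> * W s \<omega>"
  have [measurable]: "W t \<in> borel_measurable M" if "t \<in> space U" for t
    using measurable_compose[OF measurable_Pair1'[OF that] W] by simp
  have V[measurable]: "(\<lambda>(p, \<omega>). ?V p \<omega>) \<in> borel_measurable ((U \<Otimes>\<^sub>M U) \<Otimes>\<^sub>M M)"
    by (simp add: case_prod_beta') measurable
  have VL1: "(\<integral>\<^sup>+\<omega>. ennreal \<bar>?V p \<omega>\<bar> \<partial>M) \<le> ennreal B" if p_in: "p \<in> space (U \<Otimes>\<^sub>M U)" for p
  proof -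
    obtain t s where p: "p = (t, s)" and ts: "t \<in> space U" "s \<in> space U"
      using p_in by (auto simp: space_pair_measure)
    have [measurable]: "W t \<in> borel_measurable M" "W s \<in> borel_measurable M"
      using ts by simp_all
    have half: "ennreal ((1/2) * (a + b)) = ennreal (1/2) * (ennreal a + ennreal b)"
      if "a \<ge> 0" "b \<ge> 0" for a b
      by (subst ennreal_mult) (use that in auto)
    have "\<bar>W t \<omega> * W s \<omega>\<bar> \<le> (1/2) * ((W t \<omega>)\<^sup>2 + (W s \<omega>)\<^sup>2)" for \<omega>
      using sum_squares_bound[of "\<bar>W t \<omega>\<bar>" "\<bar>W s \<omega>\<bar>"] by (simp add: abs_mult)
    then have "ennreal \<bar>W t \<omega> * W s \<omega>\<bar> \<le> ennreal (1/2) * (ennreal ((W t \<omega>)\<^sup>2) + ennreal ((W s \<omega>)\<^sup>2))"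
      for \<omega>
      by (metis ennreal_leI half zero_le_power2)
    then have "(\<integral>\<^sup>+\<omega>. ennreal \<bar>W t \<omega> * W s \<omega>\<bar> \<partial>M)
        \<le> (\<integral>\<^sup>+\<omega>. ennreal (1/2) * (ennreal ((W t \<omega>)\<^sup>2) + ennreal ((W s \<omega>)\<^sup>2)) \<partial>M)"
      by (intro nn_integral_mono)
    also have "\<dots> = ennreal (1/2) * ((\<integral>\<^sup>+\<omega>. ennreal ((W t \<omega>)\<^sup>2) \<partial>M) + (\<integral>\<^sup>+\<omega>. ennreal ((W s \<omega>)\<^sup>2) \<partial>M))"
      by (simp add: nn_integral_cmult nn_integral_add)
    also have "\<dots> \<le> ennreal (1/2) * (ennreal B + ennreal B)"
      by (intro mult_left_mono add_mono second ts) auto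
    also have "\<dots> = ennreal B"
      using half[of B B] by (cases "B \<ge> 0") (simp_all add: ennreal_neg)
    finally show ?thesis
      by (simp add: p)
  qed
  have "integrable ((U \<Otimes>\<^sub>M U) \<Otimes>\<^sub>M M) (\<lambda>(p, \<omega>). ?V p \<omega>)"
  proof (rule integrableI_bounded[OF V])
    have "(\<integral>\<^sup>+x. ennreal (norm (case x of (p, \<omega>) \<Rightarrow> ?V p \<omega>)) \<partial>((U \<Otimes>\<^sub>M U) \<Otimes>\<^sub>M M))
        = (\<integral>\<^sup>+p. (\<integral>\<^sup>+\<omega>. ennreal \<bar>?V p \<omega>\<bar> \<partial>M) \<partial>(U \<Otimes>\<^sub>M U))"
      by (subst M.nn_integral_fst[symmetric]) (auto simp: case_prod_beta')
    also have "\<dots> \<le> (\<integral>\<^sup>+p. ennreal B \<partial>(U \<Otimes>\<^sub>M U))"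
      by (intro nn_integral_mono VL1)
    also have "\<dots> < \<infinity>"
      by (simp add: UU.emeasure_space_1)
    finally show "(\<integral>\<^sup>+x. ennreal (norm (case x of (p, \<omega>) \<Rightarrow> ?V p \<omega>)) \<partial>((U \<Otimes>\<^sub>M U) \<Otimes>\<^sub>M M)) < \<infinity>" .
  qed
  note Vint = this
  have sq: "(\<integral>t. W t \<omega> \<partial>U)\<^sup>2 = (\<integral>p. ?V p \<omega> \<partial>(U \<Otimes>\<^sub>M U))" if \<omega>: "\<omega> \<in> space M" for \<omega>
  proof -
    have i: "integrable (U \<Otimes>\<^sub>M U) (\<lambda>(t, s). W t \<omega> * W s \<omega>)"
      using path[OF \<omega>] by (intro UU.Fubini_integrable) (auto simp: abs_mult)
    have "(\<integral>p. ?V p \<omega> \<partial>(U \<Otimes>\<^sub>M U)) = (\<integral>t. (\<integral>s. W t \<omega> * W s \<omega> \<partial>U) \<partial>U)"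
      using UU.integral_fst'[OF i] by (simp add: case_prod_beta')
    then show ?thesis
      by (simp add: power2_eq_square)
  qed
  have "(\<integral>\<omega>. (\<integral>t. W t \<omega> \<partial>U)\<^sup>2 \<partial>M) = (\<integral>\<omega>. (\<integral>p. ?V p \<omega> \<partial>(U \<Otimes>\<^sub>M U)) \<partial>M)"
    by (intro Bochner_Integration.integral_cong refl sq)
  also have "\<dots> = (\<integral>p. (\<integral>\<omega>. ?V p \<omega> \<partial>M) \<partial>(U \<Otimes>\<^sub>M U))"
    by (rule P.Fubini_integral) (use Vint in simp)
  also have "\<dots> = (\<integral>t. (\<integral>s. (\<integral>\<omega>. W t \<omega> * W s \<omega> \<partial>M) \<partial>U) \<partial>U)"
    using UU.integral_fst'[OF P.integrable_fst'[OF Vint]] by (simp add: case_prod_beta')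
  finally show ?thesis .
qed

section \<open>Averages over an interval\<close>

abbreviation uniform_time :: "real \<Rightarrow> real measure" where
  "uniform_time T \<equiv> uniform_measure lborel {0..T}"

lemma prob_space_uniform_time: "T > 0 \<Longrightarrow> prob_space (uniform_time T)"
  by (intro prob_space_uniform_measure) auto

lemma AE_uniform_time: "AE t in uniform_time T. t \<in> {0..T}"
  by (intro AE_uniform_measureI) auto

lemma integral_uniform_time:
  fixes h :: "real \<Rightarrow> real"
  assumes "T > 0" and [measurable]: "h \<in> borel_measurable borel"
  shows "(\<integral>t. h t \<partial>uniform_time T) = 1 / T * (LBINT t:{0..T}. h t)"
proof -
  have "uniform_time T = density lborel (\<lambda>t. ennreal (indicator {0..T} t / T))"
    unfolding uniform_measure_def
    by (intro density_cong) (auto simp: divide_ennreal assms(1) less_imp_le split: split_indicator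
        simp flip: ennreal_1 intro!: AE_I2)
  then have "(\<integral>t. h t \<partial>uniform_time T) = (\<integral>t. indicator {0..T} t / T * h t \<partial>lborel)"
    using assms(1) by (simp add: integral_real_density)
  also have "\<dots> = (\<integral>t. 1 / T * (indicator {0..T} t * h t) \<partial>lborel)"
    by simp
  also have "\<dots> = 1 / T * (LBINT t:{0..T}. h t)"
    by (simp only: set_lebesgue_integral_def real_scaleR_def integral_mult_right_zero)
  finally show ?thesis .
qed

text \<open>The integrand takes the value \<open>h i\<close> on the cell from \<open>(i - 1) d\<close> (excluded) to \<open>i d\<close>. At time
  \<open>0\<close> it is \<open>h 0\<close>, which does not occur in the sum but sits on a null set.\<close>

lemma integral_ceiling_step:
  fixes h :: "int \<Rightarrow> real"
  assumes d: "d > 0"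
  shows "set_integrable lborel {0..real n * d} (\<lambda>t. h \<lceil>t / d\<rceil>) \<and>
    (LBINT t:{0..real n * d}. h \<lceil>t / d\<rceil>) = d * (\<Sum>i=1..n. h (int i))"
proof (induction n)
  case 0
  have "AE t in lborel. indicator {0..0} t *\<^sub>R h \<lceil>t / d\<rceil> = 0"
    using AE_lborel_singleton[of 0] by eventually_elim auto
  then have "has_bochner_integral lborel (\<lambda>t. indicator {0..0} t *\<^sub>R h \<lceil>t / d\<rceil>) 0"
    by (subst has_bochner_integral_cong_AE[where g = "\<lambda>_. 0"]) auto
  then show ?case
    by (simp add: set_integrable_def set_lebesgue_integral_def has_bochner_integral_iff)
next
  case (Suc n)
  let ?I = "{real n * d<..real (Suc n) * d}"
  have step: "\<lceil>t / d\<rceil> = int (Suc n)" if "t \<in> ?I" for t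
    using that d by (intro ceiling_unique) (auto simp: field_simps)
  have elen: "emeasure lborel ?I = ennreal d"
    using d by (subst emeasure_lborel_Ioc) (simp_all add: algebra_simps)
  then have len: "measure lborel ?I = d"
    using d by (simp add: measure_def)
  have "set_integrable lborel ?I (\<lambda>_. h (int (Suc n)))"
    unfolding set_integrable_def
    by (intro integrable_scaleR_left integrable_real_indicator) (simp_all only: elen, simp_all)
  then have int: "set_integrable lborel ?I (\<lambda>t. h \<lceil>t / d\<rceil>)"
    using set_integrable_cong[of lborel lborel ?I ?I "\<lambda>t. h \<lceil>t / d\<rceil>" "\<lambda>_. h (int (Suc n))"] step
    by metis
  have "(LBINT t:?I. h \<lceil>t / d\<rceil>) = (LBINT t:?I. h (int (Suc n)))"
    by (intro set_lebesgue_integral_cong) (use step in auto)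
  also have "\<dots> = d * h (int (Suc n))"
    using len by (simp add: set_lebesgue_integral_def)
  finally have val: "(LBINT t:?I. h \<lceil>t / d\<rceil>) = d * h (int (Suc n))" .
  have un: "{0..real (Suc n) * d} = {0..real n * d} \<union> ?I"
    using d by (intro ivl_disj_un_two(8)[symmetric]) (auto simp: algebra_simps)
  show ?case
    unfolding un using Suc int val set_integral_Un[of "{0..real n * d}" ?I lborel "\<lambda>t. h \<lceil>t / d\<rceil>"]
    by (auto simp: distrib_left disjoint_iff intro!: set_integrable_Un)
qed

text \<open>With \<open>k\<^sup>2 \<le> T \<le> (k + 1)\<^sup>2\<close>, monotonicity puts \<open>A T / T\<close> between \<open>A (k\<^sup>2) / (k + 1)\<^sup>2\<close> and
  \<open>A ((k + 1)\<^sup>2) / k\<^sup>2\<close>. Squares are sparse enough for variances of order \<open>1 / T\<close> to be summable along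
  them, yet successive squares have ratio tending to \<open>1\<close>, so both bounds tend to the same limit.\<close>

lemma mono_average_tendsto_at_top:
  fixes A :: "real \<Rightarrow> real"
  assumes mono: "\<And>S T. 0 \<le> S \<Longrightarrow> S \<le> T \<Longrightarrow> A S \<le> A T"
    and nonneg: "\<And>T. 0 \<le> T \<Longrightarrow> 0 \<le> A T"
    and squares: "(\<lambda>k. A ((real (Suc k))\<^sup>2) / (real (Suc k))\<^sup>2) \<longlonglongrightarrow> L"
  shows "((\<lambda>T. A T / T) \<longlongrightarrow> L) at_top"
proof -
  define B where "B k = A ((real k)\<^sup>2) / (real k)\<^sup>2" for k
  have B: "B \<longlonglongrightarrow> L"
    using squares unfolding B_def by (rule LIMSEQ_imp_Suc)
  have BS: "(\<lambda>k. B (Suc k)) \<longlonglongrightarrow> L"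
    using B by (rule LIMSEQ_Suc)
  have ratio: "(\<lambda>k. real k / real (Suc k)) \<longlonglongrightarrow> 1"
    by (rule LIMSEQ_n_over_Suc_n)
  have ratio': "(\<lambda>k. real (Suc k) / real k) \<longlonglongrightarrow> 1"
    by (rule LIMSEQ_Suc_n_over_n)
  define k where "k T = nat \<lfloor>sqrt T\<rfloor>" for T
  have k_lim: "filterlim k sequentially at_top"
    unfolding k_def
    by (intro filterlim_compose[OF filterlim_nat_sequentially] filterlim_compose[OF filterlim_floor_sequentially] sqrt_at_top)
  have lower: "(\<lambda>k. B k * (real k / real (Suc k))\<^sup>2) \<longlonglongrightarrow> L"
    using tendsto_mult[OF B tendsto_power[OF ratio, of 2]] by simp
  have upper: "(\<lambda>k. B (Suc k) * (real (Suc k) / real k)\<^sup>2) \<longlonglongrightarrow> L"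
    using tendsto_mult[OF BS tendsto_power[OF ratio', of 2]] by simp
  show ?thesis
  proof (rule tendsto_sandwich[OF _ _ filterlim_compose[OF lower k_lim] filterlim_compose[OF upper k_lim]])
    have between: "1 \<le> k T \<and> (real (k T))\<^sup>2 \<le> T \<and> T \<le> (real (Suc (k T)))\<^sup>2" if "T \<ge> 1" for T
    proof -
      have "sqrt T \<ge> 1"
        using that by simp
      then have "1 \<le> k T" "real (k T) \<le> sqrt T" "sqrt T \<le> real (Suc (k T))"
        unfolding k_def by linarith+
      moreover have "(sqrt T)\<^sup>2 = T"
        using that by simp
      ultimately show ?thesis
        by (metis of_nat_0_le_iff power_mono order_trans zero_le_one)
    qed
    show "\<forall>\<^sub>F T in at_top. B (k T) * (real (k T) / real (Suc (k T)))\<^sup>2 \<le> A T / T"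
      using eventually_ge_at_top[of "1::real"]
    proof eventually_elim
      case (elim T)
      have "B (k T) * (real (k T) / real (Suc (k T)))\<^sup>2 = A ((real (k T))\<^sup>2) / (real (Suc (k T)))\<^sup>2"
        using between[OF elim] by (simp add: B_def power_divide)
      also have "\<dots> \<le> A T / T"
        using between[OF elim] elim by (intro frac_le nonneg mono) auto
      finally show ?case .
    qed
    show "\<forall>\<^sub>F T in at_top. A T / T \<le> B (Suc (k T)) * (real (Suc (k T)) / real (k T))\<^sup>2"
      using eventually_ge_at_top[of "1::real"]
    proof eventually_elim
      case (elim T)
      have "A T / T \<le> A ((real (Suc (k T)))\<^sup>2) / (real (k T))\<^sup>2"
        using between[OF elim] elim by (intro frac_le nonneg mono) auto
      also have "\<dots> = B (Suc (k T)) * (real (Suc (k T)) / real (k T))\<^sup>2"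
        by (simp add: B_def power_divide del: of_nat_Suc)
      finally show ?case .
    qed
  qed
qed

lemma tendsto_0_of_even_power:
  fixes x :: "nat \<Rightarrow> real"
  assumes "m > 0" and "(\<lambda>n. x n ^ (2 * m)) \<longlonglongrightarrow> 0"
  shows "x \<longlonglongrightarrow> 0"
proof -
  have "(\<lambda>n. root (2 * m) (x n ^ (2 * m))) \<longlonglongrightarrow> root (2 * m) 0"
    using assms(2) by (rule tendsto_real_root)
  moreover have "root (2 * m) (x n ^ (2 * m)) = \<bar>x n\<bar>" for n
    using real_root_power_cancel[of "2 * m" "\<bar>x n\<bar>"] assms(1) by (simp add: power_even_abs)
  ultimately have "(\<lambda>n. \<bar>x n\<bar>) \<longlonglongrightarrow> 0"
    by simp
  then show ?thesis
    by (rule tendsto_rabs_zero_cancel)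
qed

lemma integrable_of_nn_integral_le:
  fixes h :: "'a \<Rightarrow> real"
  assumes "h \<in> borel_measurable M" "\<And>\<omega>. h \<omega> \<ge> 0"
    and le: "(\<integral>\<^sup>+\<omega>. ennreal (h \<omega>) \<partial>M) \<le> ennreal B" and "B \<ge> 0"
  shows "integrable M h" "(\<integral>\<omega>. h \<omega> \<partial>M) \<le> B"
proof -
  show int: "integrable M h"
    using assms(1,2) le_less_trans[OF le ennreal_less_top]
    by (intro integrableI_bounded) simp_all
  show "(\<integral>\<omega>. h \<omega> \<partial>M) \<le> B"
    using le assms(2,4) by (simp add: nn_integral_eq_integral[OF int] ennreal_le_iff)
qed

section \<open>Stationary Gaussian processes\<close>

locale stationary_gaussian_process = prob_space M for M :: "'a measure" +
  fixes Z :: "real \<Rightarrow> 'a \<Rightarrow> real" and f :: real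
  assumes continuous: "continuous_process M Z"
    and centered: "centered_process M Z"
    and stationary: "stationary_process M Z"
    and gaussian: "gaussian_process M Z"
    and second_moment: "second_moment M Z = f"
begin

text \<open>Freezing the process at time \<open>0\<close> for negative times makes its paths continuous on the whole line
  while all bounds on moments and increments persist, so that no restriction to \<open>t \<ge> 0\<close> has to be
  carried through measurability and integration.\<close>

definition Y :: "real \<Rightarrow> 'a \<Rightarrow> real" where
  "Y t = Z (max 0 t)"

lemma Y_eq: "t \<ge> 0 \<Longrightarrow> Y t = Z t"
  by (simp add: Y_def max_def)

lemma gaussian_linear_combination: "gaussian_rv M (\<lambda>\<omega>. a * Y s \<omega> + b * Y t \<omega>)"
proof -
  have *: "gaussian_rv M (\<lambda>\<omega>. a * Z s \<omega> + b * Z t \<omega>)" if "s \<ge> 0" "t \<ge> 0" for s t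
  proof (cases "s = t")
    case True
    have "gaussian_rv M (\<lambda>\<omega>. \<Sum>u\<in>{s}. (a + b) * Z u \<omega>)"
      using gaussian[unfolded gaussian_process_def, rule_format, of "{s}" "\<lambda>_. a + b"] that by simp
    then show ?thesis
      using True by (simp add: distrib_right)
  next
    case False
    have "gaussian_rv M (\<lambda>\<omega>. \<Sum>u\<in>{s, t}. (if u = s then a else b) * Z u \<omega>)"
      using gaussian[unfolded gaussian_process_def, rule_format, of "{s, t}" "\<lambda>u. if u = s then a else b"] that
      by simp
    then show ?thesis
      using False by simp
  qed
  show ?thesis
    unfolding Y_def by (intro *) auto
qed

lemma gaussian_Y: "gaussian_rv M (Y t)"
  using gaussian_linear_combination[of 1 t 0 t] by simp

lemma gaussian_add: "gaussian_rv M (\<lambda>\<omega>. Y s \<omega> + Y t \<omega>)"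
  using gaussian_linear_combination[of 1 s 1 t] by simp

lemma gaussian_diff: "gaussian_rv M (\<lambda>\<omega>. Y s \<omega> - Y t \<omega>)"
  using gaussian_linear_combination[of 1 s "-1" t] by simp

lemma measurable_Y_fixed [measurable]: "Y t \<in> borel_measurable M"
  using gaussian_Y[of t] by (simp add: gaussian_rv_def)

lemma integrable_Y: "integrable M (Y t)" and expectation_Y: "expectation (Y t) = 0"
  using centered by (auto simp: centered_process_def Y_def)

lemma expectation_add: "expectation (\<lambda>\<omega>. Y s \<omega> + Y t \<omega>) = 0"
  and expectation_diff: "expectation (\<lambda>\<omega>. Y s \<omega> - Y t \<omega>) = 0"
  using integrable_Y expectation_Y by simp_all

lemma integrable_square:
  "integrable M (\<lambda>\<omega>. (Y t \<omega>)\<^sup>2)"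
  "integrable M (\<lambda>\<omega>. (Y s \<omega> + Y t \<omega>)\<^sup>2)"
  "integrable M (\<lambda>\<omega>. (Y s \<omega> - Y t \<omega>)\<^sup>2)"
  using centered_gaussian_even_moment[OF gaussian_Y expectation_Y, of t 1]
    centered_gaussian_even_moment[OF gaussian_add expectation_add, of s t 1]
    centered_gaussian_even_moment[OF gaussian_diff expectation_diff, of s t 1]
  by (simp_all add: has_bochner_integral_iff)

text \<open>The case \<open>u = 0\<close> says that all second moments agree.\<close>

lemma expectation_product_shift:
  assumes "h \<ge> 0" "u \<ge> 0"
  shows "expectation (\<lambda>\<omega>. Y h \<omega> * Y (u + h) \<omega>) = expectation (\<lambda>\<omega>. Y 0 \<omega> * Y u \<omega>)"
proof -
  let ?J = "{0, u}"
  let ?N = "\<Pi>\<^sub>M t\<in>?J. (borel :: real measure)"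
  have [measurable]: "(\<lambda>x. x 0 * x u) \<in> borel_measurable ?N"
    by (intro borel_measurable_times measurable_component_singleton) auto
  have [measurable]: "(\<lambda>\<omega>. \<lambda>t\<in>?J. Y (t + h) \<omega>) \<in> measurable M ?N" for h
    by (rule measurable_restrict) simp
  have shift: "distr M ?N (\<lambda>\<omega>. \<lambda>t\<in>?J. Z (t + h) \<omega>) = distr M ?N (\<lambda>\<omega>. \<lambda>t\<in>?J. Z t \<omega>)"
    using stationary assms by (simp add: stationary_process_def)
  have ext: "(\<lambda>\<omega>. \<lambda>t\<in>?J. Z (t + h) \<omega>) = (\<lambda>\<omega>. \<lambda>t\<in>?J. Y (t + h) \<omega>)" if "h \<ge> 0" for h
    using that assms by (auto simp: Y_eq fun_eq_iff restrict_def)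
  have eq: "distr M ?N (\<lambda>\<omega>. \<lambda>t\<in>?J. Y (t + h) \<omega>) = distr M ?N (\<lambda>\<omega>. \<lambda>t\<in>?J. Y (t + 0) \<omega>)"
    using shift ext[of h] ext[of 0] assms(1) by (simp only: add_0_right order_refl simp_thms)
  have "expectation (\<lambda>\<omega>. Y (0 + h) \<omega> * Y (u + h) \<omega>) = (\<integral>x. x 0 * x u \<partial>distr M ?N (\<lambda>\<omega>. \<lambda>t\<in>?J. Y (t + h) \<omega>))" for h
    by (subst integral_distr) simp_all
  from this[of h] this[of 0] eq show ?thesis
    by simp
qed

lemma expectation_square: "expectation (\<lambda>\<omega>. (Y t \<omega>)\<^sup>2) = f"
proof -
  have "expectation (\<lambda>\<omega>. (Y 0 \<omega>)\<^sup>2) = f"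
    using second_moment by (simp add: second_moment_def Y_eq)
  then show ?thesis
    using expectation_product_shift[of "max 0 t" 0] by (simp add: power2_eq_square Y_def)
qed

lemma expectation_product:
  assumes "s \<ge> 0" "t \<ge> 0"
  shows "expectation (\<lambda>\<omega>. Y t \<omega> * Y s \<omega>) = autocov M Z (t - s)"
proof -
  have *: "expectation (\<lambda>\<omega>. Y s \<omega> * Y t \<omega>) = autocov M Z (t - s)" if "0 \<le> s" "s \<le> t" for s t
    using expectation_product_shift[of s "t - s"] that by (simp add: autocov_def Y_eq)
  have even: "autocov M Z (t - s) = autocov M Z (s - t)"
    by (simp add: autocov_def abs_minus_commute)
  show ?thesis
  proof (cases "s \<le> t")
    case True
    then show ?thesis
      using *[of s t] assms by (simp add: mult.commute)
  next
    case False
    then show ?thesis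
      using *[of t s] assms unfolding even by simp
  qed
qed

lemma second_moment_nonneg: "f \<ge> 0"
  using expectation_square[of 0] by (metis integral_nonneg_AE AE_I2 zero_le_power2)

lemma expectation_square_add_le: "expectation (\<lambda>\<omega>. (Y t \<omega> + Y s \<omega>)\<^sup>2) \<le> 4 * f"
  and expectation_square_diff_le: "expectation (\<lambda>\<omega>. (Y t \<omega> - Y s \<omega>)\<^sup>2) \<le> 4 * f"
proof -
  have int: "integrable M (\<lambda>\<omega>. 2 * (Y t \<omega>)\<^sup>2 + 2 * (Y s \<omega>)\<^sup>2)"
    using integrable_square by simp
  have val: "expectation (\<lambda>\<omega>. 2 * (Y t \<omega>)\<^sup>2 + 2 * (Y s \<omega>)\<^sup>2) = 4 * f"
    using integrable_square(1) by (simp add: expectation_square)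
  have "(x + y)\<^sup>2 \<le> 2 * x\<^sup>2 + 2 * y\<^sup>2" "(x - y)\<^sup>2 \<le> 2 * x\<^sup>2 + 2 * y\<^sup>2" for x y :: real
    using sum_squares_bound[of x y] sum_squares_bound[of x "-y"] by (simp_all add: power2_sum power2_diff)
  then show "expectation (\<lambda>\<omega>. (Y t \<omega> + Y s \<omega>)\<^sup>2) \<le> 4 * f"
    "expectation (\<lambda>\<omega>. (Y t \<omega> - Y s \<omega>)\<^sup>2) \<le> 4 * f"
    unfolding val[symmetric] using int integrable_square by (intro integral_mono; simp)+
qed

text \<open>The increment of the square factors as \<open>(Y t - Y s) (Y t + Y s)\<close>; the small first factor carries
  the bound \<open>v\<close>, the second contributes at most \<open>4 f\<close>.\<close>

lemma square_increment_moment: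
  assumes "expectation (\<lambda>\<omega>. (Y t \<omega> - Y s \<omega>)\<^sup>2) \<le> v"
  shows "(\<integral>\<^sup>+\<omega>. ennreal (((Y t \<omega>)\<^sup>2 - (Y s \<omega>)\<^sup>2) ^ (2 * m)) \<partial>M)
    \<le> ennreal (gaussian_moment_ratio m * v ^ m * (4 * f) ^ m)"
proof -
  have "(\<integral>\<^sup>+\<omega>. ennreal (((Y t \<omega>)\<^sup>2 - (Y s \<omega>)\<^sup>2) ^ (2 * m)) \<partial>M)
      = (\<integral>\<^sup>+\<omega>. ennreal (((Y t \<omega> - Y s \<omega>) * (Y t \<omega> + Y s \<omega>)) ^ (2 * m)) \<partial>M)"
    by (simp add: power2_eq_square square_diff_square_factored mult.commute)
  also have "\<dots> \<le> ennreal (gaussian_moment_ratio m * expectation (\<lambda>\<omega>. (Y t \<omega> - Y s \<omega>)\<^sup>2) ^ m *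
      expectation (\<lambda>\<omega>. (Y t \<omega> + Y s \<omega>)\<^sup>2) ^ m)"
    by (rule centered_gaussian_product_moment[OF gaussian_diff expectation_diff gaussian_add expectation_add])
  also have "\<dots> \<le> ennreal (gaussian_moment_ratio m * v ^ m * (4 * f) ^ m)"
  proof -
    have "v \<ge> 0"
      by (rule order_trans[OF _ assms]) simp
    then show ?thesis
      using assms expectation_square_add_le gaussian_moment_ratio_pos[of m] second_moment_nonneg
      by (intro ennreal_leI mult_mono power_mono mult_nonneg_nonneg) auto
  qed
  finally show ?thesis .
qed

lemma continuous_on_Y: "\<omega> \<in> space M \<Longrightarrow> continuous_on A (\<lambda>t. Y t \<omega>)"
  using continuous unfolding Y_def continuous_process_def
  by (intro continuous_on_compose2[of "{0..}" "\<lambda>t. Z t \<omega>" A "max 0"] continuous_intros) auto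

lemma measurable_Y [measurable (raw)]:
  assumes [measurable]: "\<tau> \<in> borel_measurable N" "g \<in> measurable N M"
  shows "(\<lambda>x. Y (\<tau> x) (g x)) \<in> borel_measurable N"
proof -
  have "(\<lambda>x. case_prod Y (\<tau> x, g x)) \<in> borel_measurable N"
    by (rule measurable_compose[OF _ continuous_paths_jointly_measurable])
      (use continuous_on_Y in auto)
  then show ?thesis
    by simp
qed

lemma path_bounded:
  assumes "\<omega> \<in> space M"
  shows "\<exists>K. \<forall>t\<in>{0..T}. (Y t \<omega>)\<^sup>2 \<le> K"
proof -
  have "compact ((\<lambda>t. (Y t \<omega>)\<^sup>2) ` {0..T})"
    by (intro compact_continuous_image continuous_intros continuous_on_Y assms) auto
  then have "bounded ((\<lambda>t. (Y t \<omega>)\<^sup>2) ` {0..T})"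
    by (rule compact_imp_bounded)
  then show ?thesis
    unfolding bounded_iff by force
qed

lemma measurable_path [measurable]: "\<omega> \<in> space M \<Longrightarrow> (\<lambda>t. Y t \<omega>) \<in> borel_measurable borel"
  by (intro borel_measurable_continuous_onI continuous_on_Y)

lemma integrable_path:
  assumes "T > 0" and \<omega>: "\<omega> \<in> space M"
  shows "integrable (uniform_time T) (\<lambda>t. (Y t \<omega>)\<^sup>2)"
proof -
  interpret U: prob_space "uniform_time T"
    using assms(1) by (rule prob_space_uniform_time)
  obtain K where K: "\<forall>t\<in>{0..T}. (Y t \<omega>)\<^sup>2 \<le> K"
    using path_bounded[OF \<omega>] by blast
  have "AE t in uniform_time T. norm ((Y t \<omega>)\<^sup>2) \<le> K"
    using AE_uniform_time[of T] by eventually_elim (use K in auto)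
  then show ?thesis
    using \<omega> by (intro U.integrable_const_bound[of _ K]) auto
qed

lemma f_hat_eq:
  assumes "T > 0" and \<omega>: "\<omega> \<in> space M"
  shows "f_hat Z T \<omega> = (\<integral>t. (Y t \<omega>)\<^sup>2 \<partial>uniform_time T)"
proof -
  have "(LBINT t:{0..T}. (Z t \<omega>)\<^sup>2) = (LBINT t:{0..T}. (Y t \<omega>)\<^sup>2)"
    by (intro set_lebesgue_integral_cong) (auto simp: Y_eq)
  then show ?thesis
    using assms by (simp add: f_hat_def integral_uniform_time)
qed

text \<open>In this form the estimator differs from \<open>f_hat\<close> only by the rounding of time to the next grid point,
  so the two can be subtracted under one integral.\<close>

lemma f_tilde_eq:
  assumes "d > 0" "n \<ge> 1" and \<omega>: "\<omega> \<in> space M"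
  shows "f_tilde Z d n \<omega> = (\<integral>t. (Y (d * \<lceil>t / d\<rceil>) \<omega>)\<^sup>2 \<partial>uniform_time (real n * d))"
proof -
  note \<omega>[measurable]
  have "(\<integral>t. (Y (d * \<lceil>t / d\<rceil>) \<omega>)\<^sup>2 \<partial>uniform_time (real n * d))
      = 1 / (real n * d) * (LBINT t:{0..real n * d}. (Y (d * \<lceil>t / d\<rceil>) \<omega>)\<^sup>2)"
    using assms by (intro integral_uniform_time) auto
  also have "(LBINT t:{0..real n * d}. (Y (d * \<lceil>t / d\<rceil>) \<omega>)\<^sup>2) = d * (\<Sum>i=1..n. (Y (d * real i) \<omega>)\<^sup>2)"
    using integral_ceiling_step[OF assms(1), of n "\<lambda>i. (Y (d * i) \<omega>)\<^sup>2"] by simp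
  also have "(\<Sum>i=1..n. (Y (d * real i) \<omega>)\<^sup>2) = (\<Sum>i=1..n. (Z (real i * d) \<omega>)\<^sup>2)"
    using assms(1) by (intro sum.cong) (simp_all add: Y_eq mult.commute)
  finally show ?thesis
    using assms by (simp add: f_tilde_def)
qed

lemma measurable_f_hat:
  assumes "T > 0"
  shows "f_hat Z T \<in> borel_measurable M"
proof -
  interpret U: prob_space "uniform_time T"
    using assms by (rule prob_space_uniform_time)
  have "(\<lambda>\<omega>. \<integral>t. (Y t \<omega>)\<^sup>2 \<partial>uniform_time T) \<in> borel_measurable M"
  proof (rule U.borel_measurable_lebesgue_integral)
    have "borel_measurable (M \<Otimes>\<^sub>M uniform_time T) = borel_measurable (M \<Otimes>\<^sub>M borel)"
      by (intro measurable_cong_sets sets_pair_measure_cong) simp_all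
    then show "(\<lambda>(\<omega>, t). (Y t \<omega>)\<^sup>2) \<in> borel_measurable (M \<Otimes>\<^sub>M uniform_time T)"
      by simp
  qed
  then show ?thesis
    by (rule measurable_cong[THEN iffD2, rotated]) (rule f_hat_eq[OF assms])
qed

lemma measurable_f_tilde: "d > 0 \<Longrightarrow> f_tilde Z d n \<in> borel_measurable M"
proof -
  assume "d > 0"
  then have "f_tilde Z d n = (\<lambda>\<omega>. 1 / real n * (\<Sum>i=1..n. (Y (real i * d) \<omega>)\<^sup>2))"
    by (auto simp: f_tilde_def Y_eq fun_eq_iff)
  then show ?thesis
    by simp
qed

lemma f_tilde_unbiased:
  assumes "d > 0" "n \<ge> 1"
  shows "integrable M (f_tilde Z d n)" "expectation (f_tilde Z d n) = f"
proof -
  have eq: "f_tilde Z d n = (\<lambda>\<omega>. 1 / real n * (\<Sum>i=1..n. (Y (real i * d) \<omega>)\<^sup>2))"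
    using assms(1) by (auto simp: f_tilde_def Y_eq fun_eq_iff)
  show "integrable M (f_tilde Z d n)" "expectation (f_tilde Z d n) = f"
    unfolding eq using assms(2) integrable_square(1) by (simp_all add: expectation_square)
qed

section \<open>The discretization error\<close>

text \<open>The integrand of the error at time \<open>t\<close> is the increment of \<open>Y\<^sup>2\<close> between \<open>t\<close> and the next grid
  point, at distance at most \<open>d\<close>; its moment bound does not depend on \<open>t\<close> and so passes to the time
  average.\<close>

lemma discretization_error_moment:
  assumes hoelder: "\<And>s t. s \<ge> 0 \<Longrightarrow> t \<ge> 0 \<Longrightarrow>
      expectation (\<lambda>\<omega>. (Z t \<omega> - Z s \<omega>)\<^sup>2) \<le> H * \<bar>t - s\<bar> powr (2 * \<alpha>)"
    and "\<alpha> > 0" "H \<ge> 0" and d: "d > 0" and n: "n \<ge> 1"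
  shows "(\<integral>\<^sup>+\<omega>. ennreal ((f_hat Z (real n * d) \<omega> - f_tilde Z d n \<omega>) ^ (2 * m)) \<partial>M)
    \<le> ennreal (gaussian_moment_ratio m * (H * d powr (2 * \<alpha>)) ^ m * (4 * f) ^ m)"
proof -
  define T where "T = real n * d"
  define \<tau> where "\<tau> t = d * \<lceil>t / d\<rceil>" for t
  define g where "g t \<omega> = (Y t \<omega>)\<^sup>2 - (Y (\<tau> t) \<omega>)\<^sup>2" for t \<omega>
  have T: "T > 0"
    using d n by (simp add: T_def)
  interpret U: prob_space "uniform_time T"
    using T by (rule prob_space_uniform_time)
  have \<tau>: "\<bar>t - \<tau> t\<bar> \<le> d" for t
  proof -
    have "d * (t / d) \<le> \<tau> t"
      unfolding \<tau>_def using d by (intro mult_left_mono) auto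
    moreover have "d * \<lceil>t / d\<rceil> \<le> d * (t / d + 1)"
      using d by (intro mult_left_mono) linarith+
    ultimately show ?thesis
      using d by (simp add: \<tau>_def distrib_left)
  qed
  have \<tau>_in: "\<tau> t \<in> {0..T}" if "t \<in> {0..T}" for t
  proof -
    have "0 \<le> t / d" "t / d \<le> real n"
      using that d by (simp_all add: T_def pos_divide_le_eq)
    then have "\<lceil>t / d\<rceil> \<ge> 0" "\<lceil>t / d\<rceil> \<le> int n"
      by (linarith, simp add: ceiling_le_iff)
    then have "real_of_int \<lceil>t / d\<rceil> \<ge> 0" "real_of_int \<lceil>t / d\<rceil> \<le> real n"
      by linarith+
    then show ?thesis
      using d by (simp add: \<tau>_def T_def mult.commute)
  qed
  have [measurable]: "\<tau> \<in> borel_measurable borel"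
    unfolding \<tau>_def by measurable
  have AE_bound: "\<exists>K. AE t in uniform_time T. \<bar>g t \<omega>\<bar> \<le> K \<and> (Y (\<tau> t) \<omega>)\<^sup>2 \<le> K" if \<omega>: "\<omega> \<in> space M" for \<omega>
  proof -
    obtain K where K: "\<forall>t\<in>{0..T}. (Y t \<omega>)\<^sup>2 \<le> K"
      using path_bounded[OF \<omega>] by blast
    have "AE t in uniform_time T. \<bar>g t \<omega>\<bar> \<le> K \<and> (Y (\<tau> t) \<omega>)\<^sup>2 \<le> K"
      using AE_uniform_time[of T]
    proof eventually_elim
      case (elim t)
      have "(Y t \<omega>)\<^sup>2 \<le> K" "(Y (\<tau> t) \<omega>)\<^sup>2 \<le> K"
        using K elim \<tau>_in[OF elim] by blast+
      moreover have "0 \<le> (Y t \<omega>)\<^sup>2" "0 \<le> (Y (\<tau> t) \<omega>)\<^sup>2"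
        by simp_all
      ultimately show ?case
        unfolding g_def by linarith
    qed
    then show ?thesis ..
  qed
  have error: "f_hat Z T \<omega> - f_tilde Z d n \<omega> = (\<integral>t. g t \<omega> \<partial>uniform_time T)" if \<omega>: "\<omega> \<in> space M" for \<omega>
  proof -
    note \<omega>[measurable]
    obtain K where K: "AE t in uniform_time T. \<bar>g t \<omega>\<bar> \<le> K \<and> (Y (\<tau> t) \<omega>)\<^sup>2 \<le> K"
      using AE_bound[OF \<omega>] by blast
    have "integrable (uniform_time T) (\<lambda>t. (Y (\<tau> t) \<omega>)\<^sup>2)"
      by (rule U.integrable_const_bound[of _ K]) (use K in auto)
    then show ?thesis
      using f_hat_eq[OF T \<omega>] f_tilde_eq[OF d n \<omega>] integrable_path[OF T \<omega>]
      by (simp add: g_def \<tau>_def T_def)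
  qed
  have "(\<integral>\<^sup>+\<omega>. ennreal ((f_hat Z T \<omega> - f_tilde Z d n \<omega>) ^ (2 * m)) \<partial>M)
      = (\<integral>\<^sup>+\<omega>. ennreal ((\<integral>t. g t \<omega> \<partial>uniform_time T) ^ (2 * m)) \<partial>M)"
    by (intro nn_integral_cong) (simp add: error)
  also have "\<dots> \<le> ennreal (gaussian_moment_ratio m * (H * d powr (2 * \<alpha>)) ^ m * (4 * f) ^ m)"
  proof (rule time_average_even_moment_le[OF U.prob_space_axioms prob_space_axioms])
    have "borel_measurable (uniform_time T \<Otimes>\<^sub>M M) = borel_measurable (borel \<Otimes>\<^sub>M M)"
      by (intro measurable_cong_sets sets_pair_measure_cong) simp_all
    then show "(\<lambda>(t, \<omega>). g t \<omega>) \<in> borel_measurable (uniform_time T \<Otimes>\<^sub>M M)"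
      unfolding g_def by simp
    show "\<exists>K. AE t in uniform_time T. \<bar>g t \<omega>\<bar> \<le> K" if "\<omega> \<in> space M" for \<omega>
      using AE_bound[OF that] by fastforce
    fix t
    have "expectation (\<lambda>\<omega>. (Y t \<omega> - Y (\<tau> t) \<omega>)\<^sup>2) \<le> H * \<bar>max 0 t - max 0 (\<tau> t)\<bar> powr (2 * \<alpha>)"
      unfolding Y_def by (rule hoelder) auto
    also have "\<dots> \<le> H * d powr (2 * \<alpha>)"
      using \<tau>[of t] assms by (intro mult_left_mono powr_mono2) auto
    finally show "(\<integral>\<^sup>+\<omega>. ennreal (g t \<omega> ^ (2 * m)) \<partial>M)
        \<le> ennreal (gaussian_moment_ratio m * (H * d powr (2 * \<alpha>)) ^ m * (4 * f) ^ m)"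
      unfolding g_def by (rule square_increment_moment)
  qed
  finally show ?thesis
    by (simp add: T_def)
qed

text \<open>At distances of at least \<open>\<delta>\<close> the trivial bound \<open>4 f\<close> on the second moment of an increment is
  absorbed into the constant. This is what gives the mean-square bound for every step size, including
  those not small compared with \<open>\<delta>\<close>.\<close>

lemma mean_square_hoelder_global:
  assumes loc: "mean_square_hoelder M Z c \<alpha> \<delta>" and "\<alpha> > 0" "\<delta> > 0" "s \<ge> 0" "t \<ge> 0"
  shows "expectation (\<lambda>\<omega>. (Z t \<omega> - Z s \<omega>)\<^sup>2)
    \<le> max c (4 * f / \<delta> powr (2 * \<alpha>)) * \<bar>t - s\<bar> powr (2 * \<alpha>)" (is "?E \<le> ?H * _")
proof (cases "\<bar>t - s\<bar> < \<delta>")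
  case True
  then have "?E \<le> c * \<bar>t - s\<bar> powr (2 * \<alpha>)"
    using assms by (simp add: mean_square_hoelder_def)
  also have "\<dots> \<le> ?H * \<bar>t - s\<bar> powr (2 * \<alpha>)"
    by (intro mult_right_mono) auto
  finally show ?thesis .
next
  case False
  have "?E \<le> 4 * f"
    using expectation_square_diff_le[of t s] assms by (simp add: Y_eq)
  also have "\<dots> = 4 * f / \<delta> powr (2 * \<alpha>) * \<delta> powr (2 * \<alpha>)"
    using assms by simp
  also have "\<dots> \<le> ?H * \<bar>t - s\<bar> powr (2 * \<alpha>)"
    using False assms second_moment_nonneg
    by (intro mult_mono powr_mono2) (auto simp: le_max_iff_disj)
  finally show ?thesis .
qed

section \<open>Strong consistency\<close>

lemma covariance_of_squares:
  "has_bochner_integral M (\<lambda>\<omega>. ((Y t \<omega>)\<^sup>2 - f) * ((Y s \<omega>)\<^sup>2 - f)) (2 * (expectation (\<lambda>\<omega>. Y t \<omega> * Y s \<omega>))\<^sup>2)"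
proof -
  have sq: "has_bochner_integral M (\<lambda>\<omega>. (Y u \<omega>)\<^sup>2) f" for u
    using integrable_square(1) expectation_square by (simp add: has_bochner_integral_iff)
  have prod: "has_bochner_integral M (\<lambda>\<omega>. (Y t \<omega>)\<^sup>2 * (Y s \<omega>)\<^sup>2) (f * f + 2 * (expectation (\<lambda>\<omega>. Y t \<omega> * Y s \<omega>))\<^sup>2)"
    using centered_gaussian_square_product[OF gaussian_Y expectation_Y gaussian_Y expectation_Y
        gaussian_add expectation_add gaussian_diff expectation_diff, of t s]
    by (simp add: expectation_square)
  have const: "has_bochner_integral M (\<lambda>_. f * f) (f * f)"
    by (simp add: has_bochner_integral_iff prob_space)
  have "has_bochner_integral M (\<lambda>\<omega>. (Y t \<omega>)\<^sup>2 * (Y s \<omega>)\<^sup>2 - f * (Y t \<omega>)\<^sup>2 - f * (Y s \<omega>)\<^sup>2 + f * f)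
      (f * f + 2 * (expectation (\<lambda>\<omega>. Y t \<omega> * Y s \<omega>))\<^sup>2 - f * f - f * f + f * f)"
    by (intro has_bochner_integral_add has_bochner_integral_diff has_bochner_integral_mult_right prod sq const)
  then show ?thesis
    by (simp add: algebra_simps)
qed

text \<open>The variance is the average of \<open>2 \<rho>(t - s)\<^sup>2\<close> over two independent uniform times. For fixed \<open>t\<close> the
  average over \<open>s\<close> is at most \<open>2 / T\<close> times the integral of \<open>\<rho>\<^sup>2\<close> over the whole line.\<close>

lemma f_hat_variance:
  assumes "T > 0" and R: "integrable lborel (\<lambda>r. (autocov M Z r)\<^sup>2)"
  shows "(\<integral>\<^sup>+\<omega>. ennreal ((f_hat Z T \<omega> - f)\<^sup>2) \<partial>M) \<le> ennreal (2 / T * (\<integral>r. (autocov M Z r)\<^sup>2 \<partial>lborel))"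
    (is "_ \<le> ennreal (2 / T * ?R)")
proof -
  interpret U: prob_space "uniform_time T"
    using assms(1) by (rule prob_space_uniform_time)
  let ?W = "\<lambda>t \<omega>. (Y t \<omega>)\<^sup>2 - f"
  let ?A = "\<lambda>\<omega>. \<integral>t. ?W t \<omega> \<partial>uniform_time T"
  have A: "f_hat Z T \<omega> - f = ?A \<omega>" if "\<omega> \<in> space M" for \<omega>
    using f_hat_eq[OF assms(1) that] integrable_path[OF assms(1) that] U.prob_space by simp
  have "borel_measurable (uniform_time T \<Otimes>\<^sub>M M) = borel_measurable (borel \<Otimes>\<^sub>M M)"
    by (intro measurable_cong_sets sets_pair_measure_cong) simp_all
  then have meas: "(\<lambda>(t, \<omega>). ?W t \<omega>) \<in> borel_measurable (uniform_time T \<Otimes>\<^sub>M M)"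
    by simp
  have second: "(\<integral>\<^sup>+\<omega>. ennreal ((?W t \<omega>)\<^sup>2) \<partial>M) \<le> ennreal (2 * f\<^sup>2)" for t
  proof -
    have "has_bochner_integral M (\<lambda>\<omega>. (?W t \<omega>)\<^sup>2) (2 * f\<^sup>2)"
      using covariance_of_squares[of t t] expectation_square[of t] by (simp add: power2_eq_square)
    then show ?thesis
      by (simp add: nn_integral_eq_integral has_bochner_integral_iff)
  qed
  have bounded: "\<exists>K. AE t in uniform_time T. \<bar>?W t \<omega>\<bar> \<le> K" if \<omega>: "\<omega> \<in> space M" for \<omega>
  proof -
    obtain K where K: "\<forall>t\<in>{0..T}. (Y t \<omega>)\<^sup>2 \<le> K"
      using path_bounded[OF \<omega>] by blast
    have "AE t in uniform_time T. \<bar>?W t \<omega>\<bar> \<le> K + f"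
      using AE_uniform_time[of T]
    proof eventually_elim
      case (elim t)
      then have "(Y t \<omega>)\<^sup>2 \<le> K"
        using K by blast
      then show ?case
        using second_moment_nonneg zero_le_power2[of "Y t \<omega>"] by linarith
    qed
    then show ?thesis ..
  qed
  \<comment> \<open>A first, crude bound: it only serves to turn the extended integral into a finite one.\<close>
  have fin: "(\<integral>\<^sup>+\<omega>. ennreal ((?A \<omega>)\<^sup>2) \<partial>M) \<le> ennreal (2 * f\<^sup>2)"
    using time_average_even_moment_le[OF U.prob_space_axioms prob_space_axioms meas bounded, of 1] second
    by simp
  have [measurable]: "?A \<in> borel_measurable M"
    using measurable_f_hat[OF assms(1)] A
    by (subst measurable_cong[where g = "\<lambda>\<omega>. f_hat Z T \<omega> - f"]) auto
  have int: "integrable M (\<lambda>\<omega>. (?A \<omega>)\<^sup>2)"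
    by (rule integrable_of_nn_integral_le(1)[OF _ _ fin]) auto
  have inner: "(\<integral>s. expectation (\<lambda>\<omega>. ?W t \<omega> * ?W s \<omega>) \<partial>uniform_time T) \<le> 2 / T * ?R" if t: "t \<in> {0..T}" for t
  proof -
    have shift: "integrable lborel (\<lambda>s. (autocov M Z (t - s))\<^sup>2)"
      "(\<integral>s. (autocov M Z (t - s))\<^sup>2 \<partial>lborel) = ?R"
      using lborel_integrable_real_affine[OF R, of "-1" t] lborel_integral_real_affine[of "-1" "\<lambda>r. (autocov M Z r)\<^sup>2" t]
      by simp_all
    have \<rho>: "(\<lambda>r. (autocov M Z r)\<^sup>2) \<in> borel_measurable borel"
      using borel_measurable_integrable[OF R] by simp
    have [measurable]: "(\<lambda>s. (autocov M Z (t - s))\<^sup>2) \<in> borel_measurable borel"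
      "(\<lambda>s. (autocov M Z (t - max 0 s))\<^sup>2) \<in> borel_measurable borel"
      by (rule measurable_compose[OF _ \<rho>], simp)+
    have "(\<integral>s. expectation (\<lambda>\<omega>. ?W t \<omega> * ?W s \<omega>) \<partial>uniform_time T)
        = (\<integral>s. 2 * (expectation (\<lambda>\<omega>. Y t \<omega> * Y s \<omega>))\<^sup>2 \<partial>uniform_time T)"
      using has_bochner_integral_integral_eq[OF covariance_of_squares] by simp
    also have "\<dots> = (\<integral>s. 2 * (autocov M Z (t - max 0 s))\<^sup>2 \<partial>uniform_time T)"
    proof -
      have "expectation (\<lambda>\<omega>. Y t \<omega> * Y s \<omega>) = autocov M Z (t - max 0 s)" for s
        using expectation_product[of "max 0 s" t] t by (simp add: Y_def)
      then show ?thesis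
        by simp
    qed
    also have "\<dots> = (\<integral>s. 2 * (autocov M Z (t - s))\<^sup>2 \<partial>uniform_time T)"
    proof (rule integral_cong_AE)
      show "AE s in uniform_time T. 2 * (autocov M Z (t - max 0 s))\<^sup>2 = 2 * (autocov M Z (t - s))\<^sup>2"
        using AE_uniform_time[of T] by eventually_elim simp
    qed simp_all
    also have "\<dots> = 1 / T * (LBINT s:{0..T}. 2 * (autocov M Z (t - s))\<^sup>2)"
      using assms(1) by (intro integral_uniform_time) auto
    also have "(LBINT s:{0..T}. 2 * (autocov M Z (t - s))\<^sup>2) \<le> (\<integral>s. 2 * (autocov M Z (t - s))\<^sup>2 \<partial>lborel)"
      unfolding set_lebesgue_integral_def using shift(1)
      by (intro integral_mono integrable_mult_indicator) (auto split: split_indicator)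
    finally show ?thesis
      using assms(1) shift(2) by (simp add: divide_right_mono)
  qed
  have "expectation (\<lambda>\<omega>. (?A \<omega>)\<^sup>2)
      = (\<integral>t. (\<integral>s. expectation (\<lambda>\<omega>. ?W t \<omega> * ?W s \<omega>) \<partial>uniform_time T) \<partial>uniform_time T)"
    using integrable_path[OF assms(1)]
    by (intro expectation_square_time_average[OF U.prob_space_axioms prob_space_axioms meas _ second]) auto
  \<comment> \<open>If the outer integrand were not integrable, its Bochner integral would be \<open>0\<close>, and the bound
    would hold as well.\<close>
  also have "\<dots> \<le> 2 / T * ?R"
  proof (cases "integrable (uniform_time T) (\<lambda>t. \<integral>s. expectation (\<lambda>\<omega>. ?W t \<omega> * ?W s \<omega>) \<partial>uniform_time T)")
    case True
    moreover have "AE t in uniform_time T.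
        (\<integral>s. expectation (\<lambda>\<omega>. ?W t \<omega> * ?W s \<omega>) \<partial>uniform_time T) \<le> 2 / T * ?R"
      using AE_uniform_time[of T] by eventually_elim (rule inner)
    ultimately show ?thesis
      by (rule U.integral_le_const)
  next
    case False
    then show ?thesis
      using assms(1) by (simp add: not_integrable_integral_eq)
  qed
  finally have "expectation (\<lambda>\<omega>. (?A \<omega>)\<^sup>2) \<le> 2 / T * ?R" .
  then have "(\<integral>\<^sup>+\<omega>. ennreal ((?A \<omega>)\<^sup>2) \<partial>M) \<le> ennreal (2 / T * ?R)"
    by (simp add: nn_integral_eq_integral[OF int] ennreal_leI)
  moreover have "(\<integral>\<^sup>+\<omega>. ennreal ((f_hat Z T \<omega> - f)\<^sup>2) \<partial>M) = (\<integral>\<^sup>+\<omega>. ennreal ((?A \<omega>)\<^sup>2) \<partial>M)"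
    by (intro nn_integral_cong) (simp add: A)
  ultimately show ?thesis
    by simp
qed

text \<open>The variances are summable along \<open>T = (k + 1)\<^sup>2\<close>, and the integral of the squared path is monotone
  in its upper limit, which fills the gaps between squares.\<close>

lemma f_hat_strongly_consistent:
  assumes R: "integrable lborel (\<lambda>r. (autocov M Z r)\<^sup>2)"
  shows "AE \<omega> in M. ((\<lambda>T. f_hat Z T \<omega>) \<longlongrightarrow> f) at_top"
proof -
  let ?T = "\<lambda>k. (real (Suc k))\<^sup>2"
  let ?R = "\<integral>r. (autocov M Z r)\<^sup>2 \<partial>lborel"
  have "summable (\<lambda>k. 2 * ?R * inverse (?T k))"
    using inverse_power_summable[of 2, where 'a = real]
    by (intro summable_mult) (simp add: summable_Suc_iff[of "\<lambda>k. inverse ((real k)\<^sup>2)"] del: of_nat_Suc)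
  then have summable: "summable (\<lambda>k. 2 / ?T k * ?R)"
    by (simp add: field_simps)
  have "AE \<omega> in M. (\<lambda>k. (f_hat Z (?T k) \<omega> - f)\<^sup>2) \<longlonglongrightarrow> 0"
  proof (rule summable_expectation_imp_AE_tendsto_0[OF _ _ f_hat_variance[OF _ R] summable])
    show "(\<lambda>\<omega>. (f_hat Z (?T k) \<omega> - f)\<^sup>2) \<in> borel_measurable M" for k
      using measurable_f_hat[of "?T k"] by simp
  qed simp_all
  then show ?thesis
    using AE_space
  proof eventually_elim
    case (elim \<omega>)
    define A where "A T = (LBINT t:{0..T}. (Z t \<omega>)\<^sup>2)" for T
    have f_hat: "f_hat Z T \<omega> = A T / T" for T
      by (simp add: f_hat_def A_def)
    have A_eq: "A T = (LBINT t:{0..T}. (Y t \<omega>)\<^sup>2)" for T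
      unfolding A_def by (intro set_lebesgue_integral_cong) (auto simp: Y_eq)
    have int: "set_integrable lborel {0..T} (\<lambda>t. (Y t \<omega>)\<^sup>2)" for T
      by (intro borel_integrable_atLeastAtMost' continuous_intros continuous_on_Y elim(2))
    have "(\<lambda>k. f_hat Z (?T k) \<omega> - f) \<longlonglongrightarrow> 0"
      using tendsto_0_of_even_power[of 1 "\<lambda>k. f_hat Z (?T k) \<omega> - f"] elim(1) by simp
    then have "(\<lambda>k. A (?T k) / ?T k) \<longlonglongrightarrow> f"
      unfolding f_hat by (rule LIM_zero_cancel)
    moreover have "A S \<le> A T" if "0 \<le> S" "S \<le> T" for S T
      unfolding A_eq set_lebesgue_integral_def using int that
      by (intro integral_mono) (auto simp: set_integrable_def split: split_indicator)
    moreover have "0 \<le> A T" for T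
      unfolding A_def set_lebesgue_integral_def by (intro integral_nonneg_AE) auto
    ultimately show ?case
      unfolding f_hat by (intro mono_average_tendsto_at_top)
  qed
qed

text \<open>Moments of arbitrarily high order are what makes every polynomial rate \<open>\<eta>\<close> sufficient: since
  \<open>\<Delta> n powr \<eta> \<le> 1 / n\<close> eventually, the moment of order \<open>2 m\<close> is at most a constant times
  \<open>n powr - (2 \<alpha> m / \<eta>)\<close>, and \<open>m \<ge> \<eta> / \<alpha>\<close> makes this \<open>O(1 / n\<^sup>2)\<close>.\<close>

lemma discretization_error_AE_tendsto_0:
  fixes \<Delta> :: "nat \<Rightarrow> real"
  assumes hoelder: "\<And>s t. s \<ge> 0 \<Longrightarrow> t \<ge> 0 \<Longrightarrow>
      expectation (\<lambda>\<omega>. (Z t \<omega> - Z s \<omega>)\<^sup>2) \<le> H * \<bar>t - s\<bar> powr (2 * \<alpha>)"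
    and \<alpha>: "\<alpha> > 0" and H: "H \<ge> 0"
    and \<Delta>: "\<And>n. n \<ge> 1 \<Longrightarrow> \<Delta> n > 0"
    and \<eta>: "\<eta> > 0" and lim: "(\<lambda>n. real n * \<Delta> n powr \<eta>) \<longlonglongrightarrow> 0"
  shows "AE \<omega> in M. (\<lambda>n. f_hat Z (real n * \<Delta> n) \<omega> - f_tilde Z (\<Delta> n) n \<omega>) \<longlonglongrightarrow> 0"
proof -
  let ?e = "\<lambda>n \<omega>. f_hat Z (real n * \<Delta> n) \<omega> - f_tilde Z (\<Delta> n) n \<omega>"
  define m where "m = Suc (nat \<lceil>\<eta> / \<alpha>\<rceil>)"
  have "\<eta> / \<alpha> \<le> real m"
    unfolding m_def by linarith
  then have m: "m > 0" "2 \<le> 2 * \<alpha> * real m / \<eta>"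
    using \<alpha> \<eta> by (simp_all add: m_def field_simps)
  define C where "C = gaussian_moment_ratio m * H ^ m * (4 * f) ^ m"
  have C: "C \<ge> 0"
    using gaussian_moment_ratio_pos[of m] H second_moment_nonneg by (simp add: C_def)
  have "\<forall>\<^sub>F n in sequentially. real n * \<Delta> n powr \<eta> < 1"
    using lim by (rule order_tendstoD(2)) simp
  then obtain N where N: "\<And>n. n \<ge> N \<Longrightarrow> real n * \<Delta> n powr \<eta> < 1"
    unfolding eventually_sequentially by blast
  \<comment> \<open>The shift by \<open>Suc N\<close> instead of \<open>N\<close> keeps the index positive.\<close>
  define k where "k j = j + Suc N" for j
  have moment: "(\<integral>\<^sup>+\<omega>. ennreal (?e (k j) \<omega> ^ (2 * m)) \<partial>M) \<le> ennreal (C * inverse ((real (k j))\<^sup>2))" for j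
  proof -
    have k: "k j \<ge> 1" "k j \<ge> N"
      by (simp_all add: k_def)
    have pos: "\<Delta> (k j) > 0"
      using \<Delta> k by simp
    have small: "\<Delta> (k j) powr \<eta> \<le> 1 / real (k j)"
      using N[OF k(2)] k(1) by (simp add: field_simps)
    have "(\<Delta> (k j) powr (2 * \<alpha>)) ^ m = (\<Delta> (k j) powr \<eta>) powr (2 * \<alpha> * real m / \<eta>)"
      using pos \<eta> by (simp add: powr_powr powr_realpow[symmetric])
    also have "\<dots> \<le> (1 / real (k j)) powr (2 * \<alpha> * real m / \<eta>)"
      using small m \<alpha> by (intro powr_mono2) auto
    also have "\<dots> \<le> (1 / real (k j)) powr 2"
      using m k by (intro powr_mono') auto
    also have "\<dots> = inverse ((real (k j))\<^sup>2)"
      using k by (simp add: powr_numeral power_divide inverse_eq_divide)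
    finally have rate: "(\<Delta> (k j) powr (2 * \<alpha>)) ^ m \<le> inverse ((real (k j))\<^sup>2)" .
    have "(\<integral>\<^sup>+\<omega>. ennreal (?e (k j) \<omega> ^ (2 * m)) \<partial>M)
        \<le> ennreal (gaussian_moment_ratio m * (H * \<Delta> (k j) powr (2 * \<alpha>)) ^ m * (4 * f) ^ m)"
      by (rule discretization_error_moment[OF hoelder \<alpha> H pos k(1)])
    also have "gaussian_moment_ratio m * (H * \<Delta> (k j) powr (2 * \<alpha>)) ^ m * (4 * f) ^ m
        = C * (\<Delta> (k j) powr (2 * \<alpha>)) ^ m"
      by (simp add: C_def power_mult_distrib)
    also have "ennreal (C * (\<Delta> (k j) powr (2 * \<alpha>)) ^ m) \<le> ennreal (C * inverse ((real (k j))\<^sup>2))"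
      using rate C by (intro ennreal_leI mult_left_mono)
    finally show ?thesis .
  qed
  have "AE \<omega> in M. (\<lambda>j. ?e (k j) \<omega> ^ (2 * m)) \<longlonglongrightarrow> 0"
  proof (rule summable_expectation_imp_AE_tendsto_0[OF _ _ moment])
    show "(\<lambda>\<omega>. ?e (k j) \<omega> ^ (2 * m)) \<in> borel_measurable M" for j
    proof -
      have "k j \<ge> 1"
        by (simp add: k_def)
      then have "\<Delta> (k j) > 0" "real (k j) * \<Delta> (k j) > 0"
        using \<Delta> by simp_all
      then show ?thesis
        using measurable_f_hat measurable_f_tilde by simp
    qed
    show "summable (\<lambda>j. C * inverse ((real (k j))\<^sup>2))"
    proof (rule summable_mult)
      have "summable (\<lambda>n. inverse ((real n)\<^sup>2))"
        using inverse_power_summable[of 2, where 'a = real] by simp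
      then show "summable (\<lambda>j. inverse ((real (k j))\<^sup>2))"
        unfolding k_def by (rule summable_ignore_initial_segment)
    qed
    show "?e (k j) \<omega> ^ (2 * m) \<ge> 0" for j \<omega>
      by (rule zero_le_even_power) simp
    show "C * inverse ((real (k j))\<^sup>2) \<ge> 0" for j
      using C by (intro mult_nonneg_nonneg) auto
  qed
  then show ?thesis
  proof eventually_elim
    case (elim \<omega>)
    then have "(\<lambda>j. ?e (j + Suc N) \<omega>) \<longlonglongrightarrow> 0"
      unfolding k_def by (rule tendsto_0_of_even_power[OF m(1)])
    then show ?case
      by (rule LIMSEQ_offset)
  qed
qed

end

theorem lemma3p8:
  fixes \<alpha> c f\<^sub>Z \<delta> :: real
  assumes "0 < \<alpha>" and "\<alpha> < 1" and "0 < c" and "0 < f\<^sub>Z" and "0 < \<delta>"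
  shows "\<exists>C>0. \<forall>(M :: 'a measure) (Z :: real \<Rightarrow> 'a \<Rightarrow> real) (\<Delta> :: nat \<Rightarrow> real).
    prob_space M \<and> continuous_process M Z \<and> centered_process M Z \<and> stationary_process M Z \<and>
    gaussian_process M Z \<and> second_moment M Z = f\<^sub>Z \<and>
    integrable lborel (\<lambda>r. (autocov M Z r)\<^sup>2) \<and> sampling_scheme \<Delta> \<longrightarrow>
    (\<forall>n\<ge>1. integrable M (f_tilde Z (\<Delta> n) n) \<and> (\<integral>\<omega>. f_tilde Z (\<Delta> n) n \<omega> \<partial>M) = f\<^sub>Z) \<and>
    (mean_square_hoelder M Z c \<alpha> \<delta> \<longrightarrow>
      (\<forall>n\<ge>1.
        integrable M (\<lambda>\<omega>. \<bar>f_hat Z (real n * \<Delta> n) \<omega> - f_tilde Z (\<Delta> n) n \<omega>\<bar>\<^sup>2) \<and>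
        (\<integral>\<omega>. \<bar>f_hat Z (real n * \<Delta> n) \<omega> - f_tilde Z (\<Delta> n) n \<omega>\<bar>\<^sup>2 \<partial>M)
          \<le> C * \<Delta> n powr (2 * \<alpha>)) \<and>
      ((\<exists>\<eta>>1. (\<lambda>n. real n * \<Delta> n powr \<eta>) \<longlonglongrightarrow> 0) \<longrightarrow>
        (AE \<omega> in M. (\<lambda>n. f_tilde Z (\<Delta> n) n \<omega>) \<longlonglongrightarrow> f\<^sub>Z)))"
proof -
  define H where "H = max c (4 * f\<^sub>Z / \<delta> powr (2 * \<alpha>))"
  have H: "H > 0"
    using assms(3) by (simp add: H_def less_max_iff_disj)
  define C where "C = gaussian_moment_ratio 1 * H * (4 * f\<^sub>Z)"
  have C: "C > 0"
    using gaussian_moment_ratio_pos[of 1] H assms(4) by (simp add: C_def)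
  show ?thesis
  proof (intro exI[of _ C] conjI C allI impI)
    fix M :: "'a measure" and Z :: "real \<Rightarrow> 'a \<Rightarrow> real" and \<Delta> :: "nat \<Rightarrow> real"
    assume *: "prob_space M \<and> continuous_process M Z \<and> centered_process M Z \<and> stationary_process M Z \<and>
      gaussian_process M Z \<and> second_moment M Z = f\<^sub>Z \<and>
      integrable lborel (\<lambda>r. (autocov M Z r)\<^sup>2) \<and> sampling_scheme \<Delta>"
    then interpret stationary_gaussian_process M Z f\<^sub>Z
      by (auto simp: stationary_gaussian_process_def stationary_gaussian_process_axioms_def)
    have R: "integrable lborel (\<lambda>r. (autocov M Z r)\<^sup>2)"
      and \<Delta>: "\<And>n. n \<ge> 1 \<Longrightarrow> \<Delta> n > 0"
      and horizon: "filterlim (\<lambda>n. real n * \<Delta> n) at_top sequentially"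
      using * by (auto simp: sampling_scheme_def)
    show "integrable M (f_tilde Z (\<Delta> n) n)" "(\<integral>\<omega>. f_tilde Z (\<Delta> n) n \<omega> \<partial>M) = f\<^sub>Z" if "n \<ge> 1" for n
      using f_tilde_unbiased[OF \<Delta>[OF that] that] by simp_all
    assume "mean_square_hoelder M Z c \<alpha> \<delta>"
    then have hoelder: "expectation (\<lambda>\<omega>. (Z t \<omega> - Z s \<omega>)\<^sup>2) \<le> H * \<bar>t - s\<bar> powr (2 * \<alpha>)"
      if "s \<ge> 0" "t \<ge> 0" for s t
      unfolding H_def using that assms by (intro mean_square_hoelder_global)
    {
      fix n :: nat assume n: "n \<ge> 1"
      let ?e = "\<lambda>\<omega>. f_hat Z (real n * \<Delta> n) \<omega> - f_tilde Z (\<Delta> n) n \<omega>"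
      have le: "(\<integral>\<^sup>+\<omega>. ennreal (\<bar>?e \<omega>\<bar>\<^sup>2) \<partial>M) \<le> ennreal (C * \<Delta> n powr (2 * \<alpha>))"
        using discretization_error_moment[OF hoelder assms(1) less_imp_le[OF H] \<Delta>[OF n] n, of 1]
        by (simp add: C_def mult_ac)
      have "(\<lambda>\<omega>. \<bar>?e \<omega>\<bar>\<^sup>2) \<in> borel_measurable M"
        using measurable_f_hat[of "real n * \<Delta> n"] measurable_f_tilde[of "\<Delta> n" n] \<Delta>[OF n] n by simp
      from integrable_of_nn_integral_le[OF this _ le]
      show "integrable M (\<lambda>\<omega>. \<bar>?e \<omega>\<bar>\<^sup>2)" "(\<integral>\<omega>. \<bar>?e \<omega>\<bar>\<^sup>2 \<partial>M) \<le> C * \<Delta> n powr (2 * \<alpha>)"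
        using C by simp_all
    }
    assume "\<exists>\<eta>>1. (\<lambda>n. real n * \<Delta> n powr \<eta>) \<longlonglongrightarrow> 0"
    then obtain \<eta> where "\<eta> > 1" and lim: "(\<lambda>n. real n * \<Delta> n powr \<eta>) \<longlonglongrightarrow> 0"
      by blast
    then have "\<eta> > 0"
      by simp
    have "AE \<omega> in M. (\<lambda>n. f_hat Z (real n * \<Delta> n) \<omega> - f_tilde Z (\<Delta> n) n \<omega>) \<longlonglongrightarrow> 0"
      by (rule discretization_error_AE_tendsto_0[OF hoelder assms(1) less_imp_le[OF H] \<Delta> \<open>\<eta> > 0\<close> lim])
    with f_hat_strongly_consistent[OF R]
    show "AE \<omega> in M. (\<lambda>n. f_tilde Z (\<Delta> n) n \<omega>) \<longlonglongrightarrow> f\<^sub>Z"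
    proof eventually_elim
      case (elim \<omega>)
      then show ?case
        using tendsto_diff[OF filterlim_compose[OF elim(1) horizon] elim(2)] by simp
    qed
  qed
qed

end
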